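(* Let $T>0$, $A\in\mathbb{R}^{n\times n}$, $B\in\mathbb{R}^{n\times m}$, $C\in\mathbb{R}^{m\times n}$, $D\in\mathbb{R}^{m\times m}$, $v:[0,T]\to\mathbb{R}^m$, and let $\mathcal{P}:\mathbb{R}^m\rightrightarrows\mathbb{R}^m$ be $\mathcal{P}(\zeta)=\{\eta:\eta\ge0,\ \zeta\le0,\ \langle\eta,\zeta\rangle=0\}$ (inequalities componentwise). Define $H_{\mathcal{P}}(t,x)=-Ax+B(\mathcal{P}+D)^{-1}\big(Cx+v(t)\big)$. Suppose that (i) $\Sigma(A,B,C,D)$ is passive with storage function $x\mapsto\frac12x^Tx$; (ii) $\operatorname{im}C\cap\operatorname{rint}\big(\operatorname{im}(\mathcal{P}+D)-v(t)\big)\neq\emptyset$ for all $t\in[0,T]$; (iii) $v\in AC([0,T],\mathbb{R}^m)$. Then $H_{\mathcal{P}}$ satisfies: (A1) for each $t\in[0,T]$, $H_{\mathcal{P}}(t,\cdot)$ is maximal monotone; (A2) there exists a nondecreasing absolutely continuous $\varphi:[0,T]\to\mathbb{R}$ with $\sup_{z\in\operatorname{dom}H_{\mathcal{P}}(s,\cdot)}\operatorname{dist}\big(z,\operatorname{dom}H_{\mathcal{P}}(t,\cdot)\big)\le\varphi(t)-\varphi(s)$ for all $0\le s\le t\le T$; (A3) for every $r>0$ there exists $\sigma_r\in L_1([0,T],\mathbb{R}_+)$ with $|H_{\mathcal{P}}^0(t,x)|\le\sigma_r(t)(1+|x|)$ for all $t\in[0,T]$, $x\in\mathbb{B}^n(r)\cap\operatorname{dom}H_{\mathcal{P}}(t,\cdot)$;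 (A4) $t\mapsto\operatorname{graph}H_{\mathcal{P}}(t,\cdot)$ is outer semicontinuous on $[0,T]$.
   Context: $(\mathcal{P}+D)(z)=\mathcal{P}(z)+Dz$, $(\mathcal{P}+D)^{-1}(\eta)=\{z:\eta\in\mathcal{P}(z)+Dz\}$; $\operatorname{im}G=\bigcup_xG(x)$, $\operatorname{dom}G=\{x:G(x)\ne\emptyset\}$, $\operatorname{graph}G=\{(x,y):y\in G(x)\}$; $\operatorname{rint}$ is relative interior; $\mathbb{B}^n(r)$ the closed Euclidean ball; $\operatorname{dist}(x,S)=\inf_{y\in S}|x-y|$; $H^0_{\mathcal{P}}(t,x)$ is the least-norm element of $H_{\mathcal{P}}(t,x)$. The system $\Sigma(A,B,C,D)$ is $\dot x=Ax+Bz$, $w=Cx+Dz$; passivity with storage $V(x)=\frac12x^Tx$ means $V(x(t_1))+\int_{t_1}^{t_2}z^Tw\,d\tau\le V(x(t_2))$ for all $t_1<t_2$ and all trajectories $(z,x,w)\in L_2\times AC\times L_2$ (equivalently $\begin{bmatrix}A^T+A & B-C^T\\ B^T-C & -(D+D^T)\end{bmatrix}\le0$). Outer semicontinuity at $t^*$: if $t_\ell\to t^*$, $(x_\ell,y_\ell)\in\operatorname{graph}H_{\mathcal{P}}(t_\ell,\cdot)$, $(x_\ell,y_\ell)\to(x,y)$, then $(x,y)\in\operatorname{graph}H_{\mathcal{P}}(t^*,\cdot)$.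
   Formalization: Passivity is taken as V(x(t2)) ≤ V(x(t1)) + ∫ z^T w, the direction equivalent to the stated matrix inequality; the displayed inequality is reversed, and with it the claim fails (A=1, B=C=D=0, v=1 gives H(t,x) = -x, not monotone). *)

theory Defs
  imports "HOL-Analysis.Analysis"
begin

definition abs_continuous_on :: "real set \<Rightarrow> (real \<Rightarrow> 'a::real_normed_vector) \<Rightarrow> bool" where
  "abs_continuous_on S f \<longleftrightarrow>
     (\<forall>\<epsilon>>0. \<exists>\<delta>>0. \<forall>(n::nat) (a::nat \<Rightarrow> real) b.
        (\<forall>i<n. a i \<le> b i \<and> {a i..b i} \<subseteq> S) \<and>
        (\<forall>i<n. \<forall>j<n. i \<noteq> j \<longrightarrow> b i \<le> a j \<or> b j \<le> a i) \<and>
        (\<Sum>i<n. b i - a i) < \<delta>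
        \<longrightarrow> (\<Sum>i<n. norm (f (b i) - f (a i))) < \<epsilon>)"

definition dom_op :: "('a \<Rightarrow> 'b set) \<Rightarrow> 'a set" where
  "dom_op G = {x. G x \<noteq> {}}"

definition im_op :: "('a \<Rightarrow> 'b set) \<Rightarrow> 'b set" where
  "im_op G = (\<Union>x. G x)"

definition graph_op :: "('a \<Rightarrow> 'b set) \<Rightarrow> ('a \<times> 'b) set" where
  "graph_op G = {(x, y). y \<in> G x}"

definition monotone_op :: "('a::real_inner \<Rightarrow> 'a set) \<Rightarrow> bool" where
  "monotone_op G \<longleftrightarrow>
     (\<forall>x y x' y'. y \<in> G x \<and> y' \<in> G x' \<longrightarrow> 0 \<le> (y - y') \<bullet> (x - x'))"

definition maximal_monotone_op :: "('a::real_inner \<Rightarrow> 'a set) \<Rightarrow> bool" where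
  "maximal_monotone_op G \<longleftrightarrow> monotone_op G \<and>
     (\<forall>G'. monotone_op G' \<and> graph_op G \<subseteq> graph_op G' \<longrightarrow> graph_op G' = graph_op G)"

text \<open>Least-norm element of a set (meaningful when it exists uniquely, e.g. closed convex nonempty).\<close>
definition least_norm_elem :: "'a::real_normed_vector set \<Rightarrow> 'a" where
  "least_norm_elem S = (THE y. y \<in> S \<and> (\<forall>y'\<in>S. norm y \<le> norm y'))"

definition compl_op :: "real^'m \<Rightarrow> (real^'m) set" where
  "compl_op \<zeta> = {\<eta>. (\<forall>i. 0 \<le> \<eta> $ i) \<and> (\<forall>i. \<zeta> $ i \<le> 0) \<and> \<eta> \<bullet> \<zeta> = 0}"

definition P_plus_D :: "real^'m^'m \<Rightarrow> real^'m \<Rightarrow> (real^'m) set" where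
  "P_plus_D D z = (\<lambda>p. p + D *v z) ` compl_op z"

definition P_plus_D_inv :: "real^'m^'m \<Rightarrow> real^'m \<Rightarrow> (real^'m) set" where
  "P_plus_D_inv D \<eta> = {z. \<eta> \<in> P_plus_D D z}"

definition H_P :: "real^'n^'n \<Rightarrow> real^'m^'n \<Rightarrow> real^'n^'m \<Rightarrow> real^'m^'m \<Rightarrow> (real \<Rightarrow> real^'m)
                    \<Rightarrow> real \<Rightarrow> real^'n \<Rightarrow> (real^'n) set" where
  "H_P A B C D v t x = (\<lambda>z. - (A *v x) + B *v z) ` P_plus_D_inv D (C *v x + v t)"

text \<open>Passivity of Sigma(A,B,C,D) with storage function V(x) = 1/2 x^T x:
  for all t1 < t2 and every trajectory (z,x,w) with z in L2, x absolutely continuous solving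
  x' = A x + B z (written in integral form), w = C x + D z, the dissipation inequality
  V(x(t2)) <= V(x(t1)) + int_{t1}^{t2} z^T w holds.\<close>
definition passive_std :: "real^'n^'n \<Rightarrow> real^'m^'n \<Rightarrow> real^'n^'m \<Rightarrow> real^'m^'m \<Rightarrow> bool" where
  "passive_std A B C D \<longleftrightarrow>
     (\<forall>t1 t2 (z::real \<Rightarrow> real^'m) (x::real \<Rightarrow> real^'n).
        t1 < t2 \<and>
        z measurable_on {t1..t2} \<and> (\<lambda>s. (norm (z s))\<^sup>2) integrable_on {t1..t2} \<and>
        (\<lambda>s. A *v x s + B *v z s) absolutely_integrable_on {t1..t2} \<and>
        (\<forall>t\<in>{t1..t2}. x t = x t1 + integral {t1..t} (\<lambda>s. A *v x s + B *v z s))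
        \<longrightarrow> (1/2) * (norm (x t2))\<^sup>2 \<le>
            (1/2) * (norm (x t1))\<^sup>2 + integral {t1..t2} (\<lambda>s. z s \<bullet> (C *v x s + D *v z s)))"

end

theory Submission
  imports Defs
begin

text \<open>Differentiating the dissipation inequality at time 0 turns passivity into the pointwise inequality
  x \<bullet> (A x + B z) \<le> z \<bullet> (C x + D z), which gives monotonicity. Everything else rests on Hoffman's error bound.
  The relation z \<in> (P + D)^{-1}(\<eta>) is a finite union of polyhedral cones, so it admits selections of linear
  growth and has closed images. The growth gives (A3) with constant \<sigma>; closedness gives (A4) and,
  applied to the problem regularised by \<epsilon> z, surjectivity of I + H, hence (A1) by Minty's
  criterion. Since feasibility implies solvability, the domain at time t is the projection of a polyhedron whose
  right-hand side is v(t), so it moves Lipschitz continuously with v, and the variation of v serves as \<phi> in (A2).\<close>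

subsection \<open>Hoffman's error bound\<close>

text \<open>The obstacle is that \<open>P_plus_D_inv D \<eta>\<close> may be empty or unbounded: D
  is merely positive semidefinite and nothing controls z itself. What H sees of z is
  \<open>B *v z\<close>, so the error bound is applied with \<open>B *v z\<close> prescribed as an
  additional datum; z can then be exchanged for a representative of controlled size without changing
  the value of H. The constants have to be uniform in the right-hand side, because v moves it. This
  is why they are assembled from the finitely many possible sets of active constraints. A sign
  convention runs through the formulas. Since z \<le> 0 and -H(x) = A x + B(-z), the input of the
  passive system is -z and its output is C x - D z. Whenever two solutions are compared, the
  dissipation inequality is therefore applied to minus the difference of their z. Condition (ii)
  provides a point of dom H(t, .) for every t; together with its z it is the reference point against
  which the regularised solutions are compared.\<close>

lemma conic_combination_bound:
  fixes E :: "'a::euclidean_space set"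
  assumes "finite E"
  shows "\<exists>c\<ge>0. \<forall>l. (\<forall>e\<in>E. 0 \<le> l e) \<longrightarrow>
           (\<exists>m. (\<forall>e\<in>E. 0 \<le> m e) \<and> (\<Sum>e\<in>E. m e *\<^sub>R e) = (\<Sum>e\<in>E. l e *\<^sub>R e) \<and>
                (\<Sum>e\<in>E. m e) \<le> c * norm (\<Sum>e\<in>E. l e *\<^sub>R e))"
  using assms
proof (induction E rule: finite_psubset_induct)
  case (psubset E)
  let ?good = "\<lambda>E c. \<forall>l. (\<forall>e\<in>E. (0::real) \<le> l e) \<longrightarrow>
           (\<exists>m. (\<forall>e\<in>E. 0 \<le> m e) \<and> (\<Sum>e\<in>E. m e *\<^sub>R e) = (\<Sum>e\<in>E. l e *\<^sub>R e) \<and>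
                (\<Sum>e\<in>E. m e) \<le> c * norm (\<Sum>e\<in>E. l e *\<^sub>R e))"
  \<comment> \<open>If \<open>E\<close> is independent, the coefficients are determined by the
    vector and linear in it. Otherwise a linear relation shifts weight until one generator
    \<open>k\<close> drops out, as in Caratheodory's theorem, and the induction applies to
    \<open>E - {k}\<close>.\<close>
  show ?case
  proof (cases "dependent E")
    case True
    then obtain u w where w: "w \<in> E" "u w \<noteq> 0" and u: "(\<Sum>e\<in>E. u e *\<^sub>R e) = 0"
      using dependent_finite[OF psubset.hyps(1)] by blast
    obtain nu where nu: "nu w > 0" "(\<Sum>e\<in>E. nu e *\<^sub>R e) = 0"
    proof (cases "u w > 0")
      case False
      then show ?thesis
        using w u by (intro that[of "\<lambda>e. - u e"]) (auto simp: sum_negf)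
    qed (use that u in blast)
    have "\<forall>k\<in>E. \<exists>c\<ge>0. ?good (E - {k}) c"
      by (intro ballI psubset.IH) auto
    then obtain c where "\<forall>k\<in>E. 0 \<le> c k \<and> ?good (E - {k}) (c k)"
      by (rule bchoice[THEN exE]) blast
    then have c: "\<And>k. k \<in> E \<Longrightarrow> 0 \<le> c k" "\<And>k. k \<in> E \<Longrightarrow> ?good (E - {k}) (c k)"
      by blast+
    \<comment> \<open>Which generator drops out depends on \<open>l\<close>, so the constant adds up
      those of all \<open>E - {k}\<close>.\<close>
    have "?good E (\<Sum>k\<in>E. c k)"
    proof (intro allI impI)
      fix l assume l: "\<forall>e\<in>E. (0::real) \<le> l e"
      define P where "P = {e\<in>E. nu e > 0}"
      have P: "finite P" "w \<in> P" using psubset.hyps w nu by (auto simp: P_def)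
      \<comment> \<open>\<open>t\<close> is the largest step along \<open>- nu\<close> that keeps
        all coefficients nonnegative; the minimiser \<open>k\<close> then has coefficient 0. Because
        \<open>nu w > 0\<close>, the set \<open>P\<close> is nonempty.\<close>
      define t where "t = Min ((\<lambda>e. l e / nu e) ` P)"
      have "t \<in> (\<lambda>e. l e / nu e) ` P" unfolding t_def using P by (intro Min_in) auto
      then obtain k where k: "k \<in> P" "t = l k / nu k" by auto
      have t_le: "t \<le> l e / nu e" if "e \<in> P" for e
        unfolding t_def using P that by (intro Min_le) auto
      have t0: "0 \<le> t" using k l by (auto simp: P_def)
      define l' where "l' = (\<lambda>e. l e - t * nu e)"
      have kE: "k \<in> E" and "l' k = 0" using k by (auto simp: P_def l'_def)
      have l': "0 \<le> l' e" if "e \<in> E" for e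
      proof (cases "nu e > 0")
        case True
        then show ?thesis using t_le[of e] that by (simp add: P_def l'_def pos_le_divide_eq)
      next
        case False
        then have "t * nu e \<le> 0" using t0 by (simp add: mult_nonneg_nonpos)
        then show ?thesis using bspec[OF l that] by (simp add: l'_def)
      qed
      have "(\<Sum>e\<in>E. l' e *\<^sub>R e) = (\<Sum>e\<in>E. l e *\<^sub>R e) - t *\<^sub>R (\<Sum>e\<in>E. nu e *\<^sub>R e)"
        by (simp add: l'_def algebra_simps sum_subtractf scaleR_sum_right)
      then have eq1: "(\<Sum>e\<in>E. l' e *\<^sub>R e) = (\<Sum>e\<in>E. l e *\<^sub>R e)" using nu by simp
      have eq2: "(\<Sum>e\<in>E - {k}. l' e *\<^sub>R e) = (\<Sum>e\<in>E. l' e *\<^sub>R e)"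
        using kE psubset.hyps \<open>l' k = 0\<close> by (simp add: sum_diff1)
      obtain m where m: "\<forall>e\<in>E - {k}. 0 \<le> m e"
        "(\<Sum>e\<in>E - {k}. m e *\<^sub>R e) = (\<Sum>e\<in>E. l e *\<^sub>R e)"
        "(\<Sum>e\<in>E - {k}. m e) \<le> c k * norm (\<Sum>e\<in>E. l e *\<^sub>R e)"
        using c(2)[OF kE, rule_format, of l'] l' eq1 eq2 by auto
      define m' where "m' = m(k := 0)"
      have "(\<Sum>e\<in>E. m' e *\<^sub>R e) = (\<Sum>e\<in>E - {k}. m e *\<^sub>R e)"
        by (intro sum.mono_neutral_cong_right) (use psubset.hyps in \<open>auto simp: m'_def\<close>)
      moreover have "(\<Sum>e\<in>E. m' e) = (\<Sum>e\<in>E - {k}. m e)"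
        by (intro sum.mono_neutral_cong_right) (use psubset.hyps in \<open>auto simp: m'_def\<close>)
      moreover have "c k \<le> (\<Sum>k\<in>E. c k)"
        using psubset.hyps c(1) kE by (intro member_le_sum) auto
      then have "c k * norm (\<Sum>e\<in>E. l e *\<^sub>R e) \<le> (\<Sum>k\<in>E. c k) * norm (\<Sum>e\<in>E. l e *\<^sub>R e)"
        by (intro mult_right_mono) auto
      ultimately show "\<exists>m. (\<forall>e\<in>E. 0 \<le> m e) \<and> (\<Sum>e\<in>E. m e *\<^sub>R e) = (\<Sum>e\<in>E. l e *\<^sub>R e) \<and>
                (\<Sum>e\<in>E. m e) \<le> (\<Sum>k\<in>E. c k) * norm (\<Sum>e\<in>E. l e *\<^sub>R e)"
        using m by (intro exI[of _ m']) (auto simp: m'_def)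
    qed
    then show ?thesis using sum_nonneg[of E c] c(1) by (intro exI[of _ "\<Sum>k\<in>E. c k"]) auto
  next
    case False
    \<comment> \<open>Dual vectors: the component of \<open>e\<close> orthogonal to the span of the
      other generators, suitably scaled. Pairing a combination with \<open>y e\<close> reads off the
      coefficient of \<open>e\<close>.\<close>
    have "\<exists>y. y \<bullet> e = 1 \<and> (\<forall>f\<in>E - {e}. y \<bullet> f = 0)" if "e \<in> E" for e
    proof -
      obtain y z where yz: "y \<in> span (E - {e})" "\<And>w. w \<in> span (E - {e}) \<Longrightarrow> orthogonal z w"
        "e = y + z"
        using orthogonal_subspace_decomp_exists by blast
      have "e \<notin> span (E - {e})" using False that by (auto simp: dependent_def)
      then have "z \<noteq> 0" using yz by auto
      moreover have "z \<bullet> e = z \<bullet> z" using yz by (auto simp: orthogonal_def inner_right_distrib)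
      moreover have "z \<bullet> f = 0" if "f \<in> E - {e}" for f
        using yz(2)[OF span_base[OF that]] by (simp add: orthogonal_def)
      ultimately show ?thesis
        by (intro exI[of _ "inverse (z \<bullet> z) *\<^sub>R z"]) auto
    qed
    then obtain y where y: "\<And>e. e \<in> E \<Longrightarrow> y e \<bullet> e = 1"
        "\<And>e f. e \<in> E \<Longrightarrow> f \<in> E - {e} \<Longrightarrow> y e \<bullet> f = 0" by metis
    have "?good E (\<Sum>e\<in>E. norm (y e))"
    proof (intro allI impI exI conjI)
      fix l assume l: "\<forall>e\<in>E. (0::real) \<le> l e"
      have "l e \<le> norm (y e) * norm (\<Sum>e\<in>E. l e *\<^sub>R e)" if "e \<in> E" for e
      proof -
        have "y e \<bullet> (\<Sum>f\<in>E. l f *\<^sub>R f) = (\<Sum>f\<in>{e}. l f * (y e \<bullet> f))"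
          unfolding inner_sum_right inner_scaleR_right
          by (intro sum.mono_neutral_right) (use psubset.hyps that y in auto)
        also have "\<dots> = l e" using y that by simp
        finally show ?thesis by (metis Cauchy_Schwarz_ineq2 abs_le_D1)
      qed
      then show "(\<Sum>e\<in>E. l e) \<le> (\<Sum>e\<in>E. norm (y e)) * norm (\<Sum>e\<in>E. l e *\<^sub>R e)"
        by (simp add: sum_distrib_right sum_mono)
    qed auto
    then show ?thesis by (intro exI[of _ "\<Sum>e\<in>E. norm (y e)"]) (simp add: sum_nonneg)
  qed
qed

lemma convex_cone_hull_finite:
  fixes E :: "'a::real_vector set"
  assumes "finite E" "x \<in> convex_cone hull E"
  obtains l where "\<forall>e\<in>E. 0 \<le> l e" "x = (\<Sum>e\<in>E. l e *\<^sub>R e)"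
proof (cases "E = {}")
  case True
  then show ?thesis using assms that by simp
next
  case False
  then obtain y c where y: "y \<in> convex hull E" "0 \<le> c" "x = c *\<^sub>R y"
    using assms by (auto simp: convex_cone_hull_convex_hull_nonempty)
  then obtain u where "\<forall>e\<in>E. 0 \<le> u e" "(\<Sum>e\<in>E. u e *\<^sub>R e) = y"
    using convex_hull_finite[OF assms(1)] by auto
  then show ?thesis
    using y by (intro that[of "\<lambda>e. c * u e"]) (auto simp: scaleR_sum_right)
qed

text \<open>Finitely generated cones are closed and convex, so \<open>x\<close> can be strictly
  separated from the cone. Since the cone contains 0, the level \<open>b\<close> is negative; a
  generator on which the functional is negative would have a positive multiple at level exactly
  \<open>b\<close>, contradicting strictness.\<close>

lemma farkas:
  fixes E :: "'a::euclidean_space set"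
  assumes "finite E" "x \<notin> convex_cone hull E"
  obtains w where "\<And>e. e \<in> E \<Longrightarrow> e \<bullet> w \<le> 0" "x \<bullet> w > 0"
proof -
  let ?K = "convex_cone hull E"
  obtain a b where ab: "a \<bullet> x < b" "\<And>y. y \<in> ?K \<Longrightarrow> a \<bullet> y > b"
    using separating_hyperplane_closed_point[of ?K x] assms
    by (metis closed_convex_cone_hull convex_convex_cone_hull)
  have "b < 0" using ab(2)[OF convex_cone_hull_contains_0] by simp
  have "a \<bullet> e \<ge> 0" if "e \<in> E" for e
  proof (rule ccontr)
    assume "\<not> ?thesis"
    then have neg: "a \<bullet> e < 0" by simp
    have "(b / (a \<bullet> e)) *\<^sub>R e \<in> ?K"
      using neg \<open>b < 0\<close> that
      by (intro convex_cone_hull_mul hull_inc) (auto simp: divide_nonpos_nonpos)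
    from ab(2)[OF this] show False using neg by simp
  qed
  then show ?thesis
    using ab \<open>b < 0\<close> by (intro that[of "- a"]) (auto simp: inner_commute)
qed

text \<open>The point of least norm satisfies a KKT condition with multipliers on the active constraints,
  and these multipliers can be chosen of size proportional to its norm.\<close>
lemma hoffman_bound:
  fixes e :: "'i \<Rightarrow> 'a::euclidean_space"
  assumes "finite I"
  shows "\<exists>c\<ge>0. \<forall>r. (\<exists>d. \<forall>i\<in>I. e i \<bullet> d \<le> r i) \<longrightarrow>
           (\<exists>d. (\<forall>i\<in>I. e i \<bullet> d \<le> r i) \<and> norm d \<le> c * (\<Sum>i\<in>I. max 0 (- r i)))"
proof -
  let ?good = "\<lambda>E c. \<forall>l. (\<forall>e\<in>E. (0::real) \<le> l e) \<longrightarrow>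
           (\<exists>m. (\<forall>e\<in>E. 0 \<le> m e) \<and> (\<Sum>e\<in>E. m e *\<^sub>R e) = (\<Sum>e\<in>E. l e *\<^sub>R e) \<and>
                (\<Sum>e\<in>E. m e) \<le> c * norm (\<Sum>e\<in>E. l e *\<^sub>R (e::'a)))"
  have "\<forall>E\<in>Pow (e ` I). \<exists>c\<ge>0. ?good E c"
    using assms by (intro ballI conic_combination_bound) (auto intro: finite_subset)
  then obtain c where "\<forall>E\<in>Pow (e ` I). 0 \<le> c E \<and> ?good E (c E)"
    by (rule bchoice[THEN exE]) blast
  then have c: "\<And>E. E \<subseteq> e ` I \<Longrightarrow> 0 \<le> c E" "\<And>E. E \<subseteq> e ` I \<Longrightarrow> ?good E (c E)"
    by blast+
  \<comment> \<open>The constraints active at the point of least norm depend on \<open>r\<close>.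
    Summing over all sets of normals gives a constant that does not.\<close>
  define C where "C = (\<Sum>E\<in>Pow (e ` I). c E)"
  have C0: "0 \<le> C" unfolding C_def using c(1) by (intro sum_nonneg) auto
  have cC: "c E \<le> C" if "E \<subseteq> e ` I" for E
    unfolding C_def using assms c(1) that by (intro member_le_sum) auto
  have "\<exists>d. (\<forall>i\<in>I. e i \<bullet> d \<le> r i) \<and> norm d \<le> C * (\<Sum>i\<in>I. max 0 (- r i))"
    if ex: "\<exists>d. \<forall>i\<in>I. e i \<bullet> d \<le> r i" for r
  proof -
    define S where "S = {d. \<forall>i\<in>I. e i \<bullet> d \<le> r i}"
    have "S = (\<Inter>i\<in>I. {d. e i \<bullet> d \<le> r i})" by (auto simp: S_def)
    then have "closed S" by (auto intro!: closed_INT closed_halfspace_le)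
    moreover have "S \<noteq> {}" using ex by (auto simp: S_def)
    ultimately obtain d where d: "d \<in> S" "\<And>y. y \<in> S \<Longrightarrow> norm d \<le> norm y"
      using closest_point_exists[of S 0] by (metis dist_0_norm)
    define R where "R = (\<Sum>i\<in>I. max 0 (- r i))"
    define E where "E = e ` {i\<in>I. e i \<bullet> d = r i}"
    have EI: "E \<subseteq> e ` I" and finE: "finite E" using assms by (auto simp: E_def)
    have "- d \<in> convex_cone hull E"
    proof (rule ccontr)
      assume "- d \<notin> convex_cone hull E"
      then obtain w where w: "\<And>e. e \<in> E \<Longrightarrow> e \<bullet> w \<le> 0" "(- d) \<bullet> w > 0"
        using farkas[OF finE] by blast
      \<comment> \<open>\<open>w\<close> is a feasible descent direction: it does not increase
        active constraints, inactive ones have slack for small \<open>h\<close>, and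
        \<open>d \<bullet> w < 0\<close> makes the norm decrease to first order. This contradicts
        the minimality of \<open>d\<close>.\<close>
      have "\<forall>\<^sub>F h in at_right 0. \<forall>i\<in>I. e i \<bullet> (d + h *\<^sub>R w) \<le> r i"
      proof (rule eventually_ball_finite[OF assms], intro ballI)
        fix i assume i: "i \<in> I"
        show "\<forall>\<^sub>F h in at_right 0. e i \<bullet> (d + h *\<^sub>R w) \<le> r i"
        proof (cases "e i \<bullet> d = r i")
          case True
          then have "e i \<bullet> w \<le> 0" using w i by (auto simp: E_def)
          then show ?thesis using True
            by (auto simp: eventually_at_filter inner_right_distrib mult_nonneg_nonpos)
        next
          case False
          then have "e i \<bullet> (d + 0 *\<^sub>R w) < r i" using d i by (auto simp: S_def order_less_le)
          moreover have "((\<lambda>h. e i \<bullet> (d + h *\<^sub>R w)) \<longlongrightarrow> e i \<bullet> (d + 0 *\<^sub>R w)) (at_right 0)"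
            by (intro tendsto_intros)
          ultimately have "\<forall>\<^sub>F h in at_right 0. e i \<bullet> (d + h *\<^sub>R w) < r i"
            by (intro order_tendstoD(2))
          then show ?thesis by (rule eventually_mono) simp
        qed
      qed
      moreover have "\<forall>\<^sub>F h in at_right 0. 2 * (d \<bullet> w) + h * (w \<bullet> w) < 0"
      proof -
        have "((\<lambda>h. 2 * (d \<bullet> w) + h * (w \<bullet> w)) \<longlongrightarrow> 2 * (d \<bullet> w) + 0 * (w \<bullet> w)) (at_right 0)"
          by (intro tendsto_intros)
        moreover have "2 * (d \<bullet> w) + 0 * (w \<bullet> w) < 0" using w(2) by simp
        ultimately show ?thesis by (rule order_tendstoD(2))
      qed
      moreover have "\<forall>\<^sub>F h in at_right 0. (h::real) > 0" by (simp add: eventually_at_right_less)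
      ultimately have "\<forall>\<^sub>F h in at_right 0. (\<forall>i\<in>I. e i \<bullet> (d + h *\<^sub>R w) \<le> r i) \<and>
          2 * (d \<bullet> w) + h * (w \<bullet> w) < 0 \<and> (h::real) > 0"
        by (intro eventually_conj)
      then obtain h where h: "\<forall>i\<in>I. e i \<bullet> (d + h *\<^sub>R w) \<le> r i"
          "2 * (d \<bullet> w) + h * (w \<bullet> w) < 0" "h > 0"
        using eventually_happens'[OF trivial_limit_at_right_real] by blast
      have "norm d \<le> norm (d + h *\<^sub>R w)" using d h by (auto simp: S_def)
      then have "d \<bullet> d \<le> (d + h *\<^sub>R w) \<bullet> (d + h *\<^sub>R w)" by (simp add: norm_le)
      also have "\<dots> = d \<bullet> d + h * (2 * (d \<bullet> w) + h * (w \<bullet> w))"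
        by (simp add: algebra_simps inner_commute)
      finally show False using mult_pos_neg[OF h(3) h(2)] by simp
    qed
    then obtain l where "\<forall>e\<in>E. 0 \<le> l e" "- d = (\<Sum>e\<in>E. l e *\<^sub>R e)"
      using convex_cone_hull_finite[OF finE] by blast
    then obtain m where m: "\<forall>e\<in>E. 0 \<le> m e" "- d = (\<Sum>e\<in>E. m e *\<^sub>R e)"
        "(\<Sum>e\<in>E. m e) \<le> c E * norm d"
      using c(2)[OF EI, rule_format, of l] by (auto simp flip: norm_minus_cancel[of d])
    have R: "- (y \<bullet> d) \<le> R" if "y \<in> E" for y
    proof -
      obtain i where i: "i \<in> I" "y = e i" "e i \<bullet> d = r i"
        using \<open>y \<in> E\<close> unfolding E_def by blast
      have "max 0 (- r i) \<le> R"
        unfolding R_def using assms i by (intro member_le_sum) auto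
      then show ?thesis using i by simp
    qed
    have R0: "0 \<le> R" by (auto simp: R_def intro!: sum_nonneg)
    \<comment> \<open>Pairing the multiplier representation of \<open>- d\<close> with
      \<open>d\<close> and using that every \<open>y\<close> in \<open>E\<close> is active bounds
      the squared norm by \<open>R\<close> times the sum of multipliers, which is itself at most a
      constant times \<open>norm d\<close>. One factor \<open>norm d\<close> cancels.\<close>
    have "norm d * norm d = (- (- d)) \<bullet> d" by (simp flip: power2_eq_square add: power2_norm_eq_inner)
    also have "\<dots> = (\<Sum>y\<in>E. m y * (- (y \<bullet> d)))"
      unfolding m(2) by (simp add: inner_sum_left sum_negf)
    also have "\<dots> \<le> (\<Sum>y\<in>E. m y * R)"
      using m(1) R by (intro sum_mono mult_left_mono) auto
    also have "\<dots> \<le> (c E * norm d) * R"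
      using m(3) R0 by (simp flip: sum_distrib_right add: mult_right_mono)
    also have "\<dots> \<le> (C * norm d) * R"
      using cC[OF EI] R0 by (intro mult_right_mono) auto
    finally have "norm d * norm d \<le> norm d * (C * R)" by (simp add: mult_ac)
    then have "norm d \<le> C * R"
      using C0 R0 by (cases "d = 0") auto
    then show ?thesis using d by (auto simp: S_def R_def)
  qed
  then show ?thesis using C0 by blast
qed

text \<open>The constraints are homogeneous on the product space, so \<open>q\<close> acts as the
  right-hand side. The error bound is applied to the displacement \<open>u' - u\<close>: as
  \<open>u\<close> is feasible for \<open>q\<close>, the zero displacement violates the constraints
  for \<open>q'\<close> by at most a multiple of \<open>norm (q' - q)\<close>.\<close>

lemma polyhedral_section_lipschitz:
  fixes G :: "('a::euclidean_space \<times> 'b::euclidean_space \<Rightarrow> real) set"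
  assumes "finite G" and lin: "\<forall>g\<in>G. linear g"
  shows "\<exists>c\<ge>0. \<forall>u q q'. (\<forall>g\<in>G. g (u, q) \<le> 0) \<and> (\<exists>u'. \<forall>g\<in>G. g (u', q') \<le> 0) \<longrightarrow>
           (\<exists>u'. (\<forall>g\<in>G. g (u', q') \<le> 0) \<and> norm (u' - u) \<le> c * norm (q' - q))"
proof -
  define e where "e g = (\<Sum>b\<in>Basis. g (b, 0) *\<^sub>R b)" for g :: "'a \<times> 'b \<Rightarrow> real"
  have e: "e g \<bullet> d = g (d, 0)" if "g \<in> G" for g d
  proof -
    have lg: "linear (\<lambda>d. g (d, 0))"
      using lin that linear_compose[of "\<lambda>d::'a. (d, 0::'b)" g]
      by (simp add: o_def linear_iff)
    have "g (d, 0) = (\<lambda>d. g (d, 0)) (\<Sum>b\<in>Basis. (d \<bullet> b) *\<^sub>R b)"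
      by (simp add: euclidean_representation)
    also have "\<dots> = (\<Sum>b\<in>Basis. (d \<bullet> b) * g (b, 0))"
      by (subst linear_sum[OF lg]) (simp add: linear_scale[OF lg])
    also have "\<dots> = e g \<bullet> d"
      by (simp add: e_def inner_sum_right mult.commute inner_commute[of _ d])
    finally show ?thesis by simp
  qed
  have split: "g (u', q') = g (u, q) + g (u' - u, 0) + g (0, q' - q)" if "g \<in> G" for g u u' q q'
  proof -
    have "linear g" using lin that by blast
    then have "g ((u, q) + (u' - u, 0) + (0, q' - q)) = g (u, q) + g (u' - u, 0) + g (0, q' - q)"
      by (simp only: linear_add)
    then show ?thesis by simp
  qed
  have "\<forall>g\<in>G. \<exists>K>0. \<forall>x. norm (g x) \<le> norm x * K"
    using lin by (metis bounded_linear.pos_bounded linear_conv_bounded_linear)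
  then obtain K where K: "\<And>g. g \<in> G \<Longrightarrow> 0 < K g" "\<And>g x. g \<in> G \<Longrightarrow> norm (g x) \<le> norm x * K g"
    by metis
  obtain c where c: "c \<ge> 0" "\<And>r. (\<exists>d. \<forall>g\<in>G. e g \<bullet> d \<le> r g) \<Longrightarrow>
           \<exists>d. (\<forall>g\<in>G. e g \<bullet> d \<le> r g) \<and> norm d \<le> c * (\<Sum>g\<in>G. max 0 (- r g))"
    using hoffman_bound[OF assms(1), of e] by blast
  have "\<exists>u'. (\<forall>g\<in>G. g (u', q') \<le> 0) \<and> norm (u' - u) \<le> (c * (\<Sum>g\<in>G. K g)) * norm (q' - q)"
    if u: "\<forall>g\<in>G. g (u, q) \<le> 0" and u': "\<forall>g\<in>G. g (u', q') \<le> 0" for u q u' q'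
  proof -
    let ?r = "\<lambda>g. - g (u, q) - g (0, q' - q)"
    have "e g \<bullet> (u' - u) \<le> ?r g" if "g \<in> G" for g
      using bspec[OF u' that] split[OF that, of u' q' u q] e[OF that] by simp
    then obtain d where d: "\<forall>g\<in>G. e g \<bullet> d \<le> ?r g" "norm d \<le> c * (\<Sum>g\<in>G. max 0 (- ?r g))"
      using c(2)[of ?r] by blast
    have "max 0 (- ?r g) \<le> K g * norm (q' - q)" if "g \<in> G" for g
    proof -
      have "g (0, q' - q) \<le> K g * norm (q' - q)"
        using K(2)[OF that, of "(0, q' - q)"] by (simp add: norm_Pair mult.commute abs_le_iff)
      moreover have "0 \<le> K g * norm (q' - q)" using K(1)[OF that] by simp
      ultimately show ?thesis using bspec[OF u that] by simp
    qed
    then have "(\<Sum>g\<in>G. max 0 (- ?r g)) \<le> (\<Sum>g\<in>G. K g) * norm (q' - q)"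
      by (simp only: sum_distrib_right sum_mono)
    from mult_left_mono[OF this c(1)] have "norm d \<le> (c * (\<Sum>g\<in>G. K g)) * norm (q' - q)"
      using d(2) by (simp add: mult.assoc)
    moreover have "g (u + d, q') \<le> 0" if "g \<in> G" for g
      using bspec[OF d(1) that] split[OF that, of "u + d" q' u q] e[OF that] by simp
    ultimately show ?thesis by (intro exI[of _ "u + d"]) auto
  qed
  moreover have "0 \<le> c * (\<Sum>g\<in>G. K g)"
    using c(1) K(1) by (intro mult_nonneg_nonneg sum_nonneg) (auto intro: less_imp_le)
  ultimately show ?thesis by (intro exI[of _ "c * (\<Sum>g\<in>G. K g)"]) blast
qed

subsection \<open>The linear complementarity problem\<close>

text \<open>Under the sign conditions all terms of the inner product have one sign, so orthogonality
  splits into components. Choosing which factor vanishes in each component displays the relation as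
  a finite union of polyhedral cones.\<close>

lemma mem_P_plus_D_inv:
  "z \<in> P_plus_D_inv D \<eta> \<longleftrightarrow>
     (\<forall>i. 0 \<le> (\<eta> - D *v z) $ i) \<and> (\<forall>i. z $ i \<le> 0) \<and> (\<forall>i. (\<eta> - D *v z) $ i = 0 \<or> z $ i = 0)"
proof -
  let ?p = "\<eta> - D *v z"
  have "z \<in> P_plus_D_inv D \<eta> \<longleftrightarrow> ?p \<in> compl_op z"
    by (auto simp: P_plus_D_inv_def P_plus_D_def image_iff algebra_simps intro!: bexI[of _ ?p])
  moreover have "?p \<bullet> z = 0 \<longleftrightarrow> (\<forall>i. ?p $ i = 0 \<or> z $ i = 0)"
    if "\<forall>i. 0 \<le> ?p $ i" "\<forall>i. z $ i \<le> 0"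
  proof -
    have "?p \<bullet> z = 0 \<longleftrightarrow> (\<Sum>i\<in>UNIV. ?p $ i * - (z $ i)) = 0"
      by (simp add: inner_vec_def sum_negf)
    also have "\<dots> \<longleftrightarrow> (\<forall>i\<in>UNIV. ?p $ i * - (z $ i) = 0)"
      using that by (intro sum_nonneg_eq_0_iff) (auto simp: mult_nonneg_nonpos)
    finally show ?thesis by auto
  qed
  ultimately show ?thesis by (auto simp: compl_op_def)
qed

text \<open>For a fixed set \<open>S\<close> of components where z vanishes, with the slack
  vanishing on the complement, the triples (z, \<eta>, B z) form a polyhedral cone. Keeping
  \<open>B *v z\<close> among the parameters allows z to be made small without altering what H
  sees.\<close>

lemma P_plus_D_inv_bounded_selection:
  fixes D :: "real^'m^'m" and B :: "real^'m^'n"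
  shows "\<exists>c\<ge>0. \<forall>\<eta> z. z \<in> P_plus_D_inv D \<eta> \<longrightarrow>
           (\<exists>z'\<in>P_plus_D_inv D \<eta>. B *v z' = B *v z \<and> norm z' \<le> c * norm (\<eta>, B *v z))"
proof -
  define G :: "'m set \<Rightarrow> ((real^'m) \<times> (real^'m) \<times> (real^'n) \<Rightarrow> real) set" where
    "G S = range (\<lambda>i w. fst w $ i) \<union> range (\<lambda>i w. - (fst (snd w) - D *v fst w) $ i)
       \<union> (\<lambda>i w. - fst w $ i) ` S \<union> (\<lambda>i w. (fst (snd w) - D *v fst w) $ i) ` (- S)
       \<union> range (\<lambda>j w. (B *v fst w - snd (snd w)) $ j) \<union> range (\<lambda>j w. - (B *v fst w - snd (snd w)) $ j)" for S
  have finG: "finite (G S)" for S by (simp add: G_def)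
  have linG: "\<forall>g\<in>G S. linear g" for S
    by (auto simp: G_def linear_iff matrix_vector_right_distrib matrix_vector_mult_scaleR algebra_simps)
  have G: "(\<forall>g\<in>G S. g (z, \<eta>, y) \<le> 0) \<longleftrightarrow>
     (\<forall>i. 0 \<le> (\<eta> - D *v z) $ i) \<and> (\<forall>i. z $ i \<le> 0) \<and> (\<forall>i\<in>S. z $ i = 0) \<and>
     (\<forall>i\<in>-S. (\<eta> - D *v z) $ i = 0) \<and> B *v z = y" for S z \<eta> y
    unfolding G_def by (auto simp: vec_eq_iff ball_Un antisym)
  have "\<forall>S. \<exists>c\<ge>0. \<forall>u q q'. (\<forall>g\<in>G S. g (u, q) \<le> 0) \<and> (\<exists>u'. \<forall>g\<in>G S. g (u', q') \<le> 0) \<longrightarrow>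
           (\<exists>u'. (\<forall>g\<in>G S. g (u', q') \<le> 0) \<and> norm (u' - u) \<le> c * norm (q' - q))"
    by (intro allI polyhedral_section_lipschitz finG linG)
  then obtain c where "\<forall>S. c S \<ge> 0 \<and> (\<forall>u q q'. (\<forall>g\<in>G S. g (u, q) \<le> 0) \<and> (\<exists>u'. \<forall>g\<in>G S. g (u', q') \<le> 0) \<longrightarrow>
           (\<exists>u'. (\<forall>g\<in>G S. g (u', q') \<le> 0) \<and> norm (u' - u) \<le> c S * norm (q' - q)))"
    by (rule choice[THEN exE]) blast
  then have c: "c S \<ge> 0" "\<lbrakk>\<forall>g\<in>G S. g (u, q) \<le> 0; \<exists>u'. \<forall>g\<in>G S. g (u', q') \<le> 0\<rbrakk> \<Longrightarrow>
      \<exists>u'. (\<forall>g\<in>G S. g (u', q') \<le> 0) \<and> norm (u' - u) \<le> c S * norm (q' - q)" for S u q q'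
    by blast+
  have "\<exists>z'\<in>P_plus_D_inv D \<eta>. B *v z' = B *v z \<and> norm z' \<le> (\<Sum>S\<in>UNIV. c S) * norm (\<eta>, B *v z)"
    if z: "z \<in> P_plus_D_inv D \<eta>" for \<eta> z
  proof -
    define S where "S = {i. z $ i = 0}"
    \<comment> \<open>The origin lies in every one of these cones, so Lipschitz dependence measured
      from it is linear growth.\<close>
    have "\<forall>g\<in>G S. g (0, 0, 0) \<le> 0" unfolding G by simp
    moreover have "\<forall>g\<in>G S. g (z, \<eta>, B *v z) \<le> 0"
      using z unfolding G mem_P_plus_D_inv by (auto simp: S_def)
    ultimately obtain z' where z': "\<forall>g\<in>G S. g (z', \<eta>, B *v z) \<le> 0"
        "norm (z' - 0) \<le> c S * norm ((\<eta>, B *v z) - (0, 0))"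
      using c(2)[of S 0 "(0, 0)" "(\<eta>, B *v z)"] by blast
    have "c S \<le> (\<Sum>S\<in>UNIV. c S)" using c(1) by (intro member_le_sum) auto
    then have "c S * norm (\<eta>, B *v z) \<le> (\<Sum>S\<in>UNIV. c S) * norm (\<eta>, B *v z)"
      by (intro mult_right_mono) auto
    then have "norm z' \<le> (\<Sum>S\<in>UNIV. c S) * norm (\<eta>, B *v z)" using z'(2) by simp
    moreover have "z' \<in> P_plus_D_inv D \<eta>" "B *v z' = B *v z"
      using z'(1) unfolding G mem_P_plus_D_inv by auto
    ultimately show ?thesis by blast
  qed
  moreover have "0 \<le> (\<Sum>S\<in>UNIV. c S)" using c(1) by (intro sum_nonneg) auto
  ultimately show ?thesis by blast
qed

text \<open>The given \<open>z l\<close> may diverge although their images under \<open>B\<close>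
  converge. Bounded representatives with the same images have a convergent subsequence, and its
  limit is the required point.\<close>

lemma P_plus_D_inv_closed:
  fixes D :: "real^'m^'m" and B :: "real^'m^'n"
  assumes z: "\<And>l. z l \<in> P_plus_D_inv D (\<eta> l)"
    and \<eta>: "\<eta> \<longlonglongrightarrow> \<eta>\<^sub>0" and y: "(\<lambda>l. B *v z l) \<longlonglongrightarrow> y"
  obtains z\<^sub>0 where "z\<^sub>0 \<in> P_plus_D_inv D \<eta>\<^sub>0" "B *v z\<^sub>0 = y"
proof -
  obtain c where c: "c \<ge> 0" "\<And>\<eta> z. z \<in> P_plus_D_inv D \<eta> \<Longrightarrow>
           \<exists>z'\<in>P_plus_D_inv D \<eta>. B *v z' = B *v z \<and> norm z' \<le> c * norm (\<eta>, B *v z)"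
    using P_plus_D_inv_bounded_selection[of D B] by blast
  have "\<forall>l. \<exists>z'. z' \<in> P_plus_D_inv D (\<eta> l) \<and> B *v z' = B *v z l \<and> norm z' \<le> c * norm (\<eta> l, B *v z l)"
    using c(2)[OF z] by blast
  then obtain z' where z': "\<And>l. z' l \<in> P_plus_D_inv D (\<eta> l)" "\<And>l. B *v z' l = B *v z l"
      "\<And>l. norm (z' l) \<le> c * norm (\<eta> l, B *v z l)"
    by metis
  have "(\<lambda>l. (\<eta> l, B *v z l)) \<longlonglongrightarrow> (\<eta>\<^sub>0, y)" using \<eta> y by (rule tendsto_Pair)
  then have "Bseq (\<lambda>l. (\<eta> l, B *v z l))" by (intro convergent_imp_Bseq convergentI)
  then obtain K where K: "\<And>l. norm (\<eta> l, B *v z l) \<le> K" by (auto simp: Bseq_def)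
  have "norm (z' l) \<le> c * K" for l
    using z'(3)[of l] mult_left_mono[OF K[of l] c(1)] by linarith
  then have "bounded (range z')" by (auto simp: bounded_iff)
  then obtain z\<^sub>0 r where r: "strict_mono r" "(z' \<circ> r) \<longlonglongrightarrow> z\<^sub>0"
    using bounded_imp_convergent_subsequence by blast
  have lz: "(\<lambda>l. z' (r l)) \<longlonglongrightarrow> z\<^sub>0" using r(2) by (simp add: o_def)
  have l\<eta>: "(\<lambda>l. \<eta> (r l)) \<longlonglongrightarrow> \<eta>\<^sub>0" and ly: "(\<lambda>l. B *v z (r l)) \<longlonglongrightarrow> y"
    using LIMSEQ_subseq_LIMSEQ[OF \<eta> r(1)] LIMSEQ_subseq_LIMSEQ[OF y r(1)] by (simp_all add: o_def)
  have mult: "(\<lambda>l. E *v z' (r l)) \<longlonglongrightarrow> E *v z\<^sub>0" for E :: "real^'m^'k"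
    by (intro bounded_linear.tendsto[OF matrix_vector_mul_bounded_linear] lz)
  have p: "(\<lambda>l. (\<eta> (r l) - D *v z' (r l)) $ i) \<longlonglongrightarrow> (\<eta>\<^sub>0 - D *v z\<^sub>0) $ i" for i
    by (intro tendsto_vec_nth tendsto_diff l\<eta> mult)
  have zi: "(\<lambda>l. z' (r l) $ i) \<longlonglongrightarrow> z\<^sub>0 $ i" for i by (intro tendsto_vec_nth lz)
  note m = z'(1)[unfolded mem_P_plus_D_inv]
  have "0 \<le> (\<eta>\<^sub>0 - D *v z\<^sub>0) $ i" for i
    using m by (intro LIMSEQ_le_const[OF p]) auto
  moreover have "z\<^sub>0 $ i \<le> 0" for i
    using m by (intro LIMSEQ_le_const2[OF zi]) auto
  moreover have "(\<eta>\<^sub>0 - D *v z\<^sub>0) $ i = 0 \<or> z\<^sub>0 $ i = 0" for i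
  proof -
    \<comment> \<open>A disjunction does not pass to limits by itself, since the vanishing factor
      may change with \<open>l\<close>; the product of the two factors does.\<close>
    have "(\<lambda>l. (\<eta> (r l) - D *v z' (r l)) $ i * z' (r l) $ i) \<longlonglongrightarrow> (\<eta>\<^sub>0 - D *v z\<^sub>0) $ i * z\<^sub>0 $ i"
      by (intro tendsto_mult p zi)
    moreover have "(\<lambda>l. (\<eta> (r l) - D *v z' (r l)) $ i * z' (r l) $ i) = (\<lambda>l. 0)"
      using m by (auto simp: fun_eq_iff)
    ultimately have "(\<eta>\<^sub>0 - D *v z\<^sub>0) $ i * z\<^sub>0 $ i = 0"
      by (metis LIMSEQ_unique tendsto_const)
    then show ?thesis by simp
  qed
  ultimately have "z\<^sub>0 \<in> P_plus_D_inv D \<eta>\<^sub>0" by (simp add: mem_P_plus_D_inv)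
  moreover have "B *v z\<^sub>0 = y"
    using mult[of B] ly by (simp add: z'(2) LIMSEQ_unique)
  ultimately show ?thesis by (rule that)
qed

section \<open>Solvability of monotone complementarity problems and of the resolvent
  equation\<close>

lemma P_plus_D_inv_strongly_monotone:
  fixes N :: "real^'m^'m"
  assumes "\<mu> > 0" and mono: "\<And>z. \<mu> * (z \<bullet> z) \<le> z \<bullet> (N *v z)"
  obtains z where "z \<in> P_plus_D_inv N \<eta>"
proof -
  obtain K where K: "K > 0" "\<And>z. norm (N *v z) \<le> norm z * K"
    using bounded_linear.pos_bounded[OF matrix_vector_mul_bounded_linear[of N]] by blast
  define L where "L = K + \<mu>"
  have L: "L > 0" "\<mu> < L" using K(1) assms(1) by (auto simp: L_def)
  have NL: "norm (N *v z) \<le> L * norm z" for z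
    using K(2)[of z] assms(1) by (simp add: L_def algebra_simps add_increasing2)
  \<comment> \<open>This step length minimises 1 - 2 \<tau> \<mu> + \<tau>^2 L^2, with minimum 1 -
    (\<mu> / L)^2, the square of the contraction factor \<open>c\<close>. Adding
    \<open>\<mu>\<close> to \<open>K\<close> in \<open>L\<close> ensures \<mu> / L < 1.\<close>
  define \<tau> where "\<tau> = \<mu> / L\<^sup>2"
  have \<tau>: "\<tau> > 0" using assms(1) L by (simp add: \<tau>_def)
  define c where "c = sqrt (1 - (\<mu> / L)\<^sup>2)"
  have muL: "0 < \<mu> / L" "\<mu> / L < 1" using assms(1) L by auto
  have sq: "(\<mu> / L)\<^sup>2 < 1" using muL by (simp add: power_less_one_iff)
  have c: "0 \<le> c" "c < 1" "c\<^sup>2 = 1 - (\<mu> / L)\<^sup>2"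
    using sq muL by (auto simp: c_def)
  \<comment> \<open>Projected fixed-point map: \<open>min 0\<close> is the projection onto the
    nonpositive orthant, and the fixed points are exactly the solutions of the complementarity
    problem.\<close>
  define f where "f = (\<lambda>z. \<chi> i. min 0 ((z + \<tau> *\<^sub>R (\<eta> - N *v z)) $ i))"
  have "dist (f z) (f w) \<le> c * dist z w" for z w
  proof -
    let ?d = "z - w"
    have "norm (f z - f w) \<le> norm (?d - \<tau> *\<^sub>R (N *v ?d))"
    proof (rule norm_le_componentwise_cart)
      fix i
      have "\<bar>min 0 a - min 0 b\<bar> \<le> \<bar>a - b\<bar>" for a b :: real by (simp add: min_def)
      from this[of "(z + \<tau> *\<^sub>R (\<eta> - N *v z)) $ i" "(w + \<tau> *\<^sub>R (\<eta> - N *v w)) $ i"]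
      show "norm ((f z - f w) $ i) \<le> norm ((?d - \<tau> *\<^sub>R (N *v ?d)) $ i)"
        by (simp add: f_def matrix_vector_mult_diff_distrib algebra_simps)
    qed
    also have "\<dots> \<le> c * norm ?d"
    proof (rule power2_le_imp_le)
      have "(norm (a - \<tau> *\<^sub>R b))\<^sup>2 = a \<bullet> a - 2 * \<tau> * (a \<bullet> b) + \<tau>\<^sup>2 * (norm b)\<^sup>2" for a b :: "real^'m"
        unfolding power2_norm_eq_inner
        by (simp add: inner_diff_left inner_diff_right inner_commute power2_eq_square)
      then have "(norm (?d - \<tau> *\<^sub>R (N *v ?d)))\<^sup>2 = ?d \<bullet> ?d - 2 * \<tau> * (?d \<bullet> (N *v ?d)) + \<tau>\<^sup>2 * (norm (N *v ?d))\<^sup>2"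
        by blast
      also have "\<dots> \<le> ?d \<bullet> ?d - 2 * \<tau> * (\<mu> * (?d \<bullet> ?d)) + \<tau>\<^sup>2 * (L * norm ?d)\<^sup>2"
        using mono[of ?d] NL[of ?d] \<tau>
        by (intro add_mono diff_mono mult_left_mono power_mono) auto
      also have "\<dots> = (1 - 2 * \<tau> * \<mu> + \<tau>\<^sup>2 * L\<^sup>2) * (norm ?d)\<^sup>2"
        by (simp add: power2_norm_eq_inner[symmetric] power_mult_distrib algebra_simps)
      also have "1 - 2 * \<tau> * \<mu> + \<tau>\<^sup>2 * L\<^sup>2 = c\<^sup>2"
        using L(1) unfolding c(3) \<tau>_def by (simp add: power2_eq_square field_simps)
      finally show "(norm (?d - \<tau> *\<^sub>R (N *v ?d)))\<^sup>2 \<le> (c * norm ?d)\<^sup>2" by (simp add: power_mult_distrib)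
    qed (use c in auto)
    finally show ?thesis by (simp add: dist_norm)
  qed
  then obtain z where z: "f z = z" using banach_fix_type[OF c(1,2), of f] by blast
  have "0 \<le> (\<eta> - N *v z) $ i \<and> z $ i \<le> 0 \<and> ((\<eta> - N *v z) $ i = 0 \<or> z $ i = 0)" for i
  proof -
    have eq: "z $ i = min 0 (z $ i + \<tau> * (\<eta> - N *v z) $ i)"
      by (subst z[symmetric]) (simp add: f_def)
    show ?thesis
    proof (cases "z $ i + \<tau> * (\<eta> - N *v z) $ i \<le> 0")
      case True
      then have "\<tau> * (\<eta> - N *v z) $ i = 0" "z $ i \<le> 0" using eq by linarith+
      then show ?thesis using \<tau> by simp
    next
      case False
      then have "z $ i = 0" "0 < \<tau> * (\<eta> - N *v z) $ i" using eq by linarith+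
      then show ?thesis using \<tau> by (simp add: zero_less_mult_iff)
    qed
  qed
  then have "z \<in> P_plus_D_inv N \<eta>" unfolding mem_P_plus_D_inv by blast
  then show ?thesis by (rule that)
qed

text \<open>If A x = x, then x . x = x . A x \<le> 0, so I - A is injective and hence invertible;
  \<open>R\<close> is its inverse. It serves to eliminate the state from the resolvent
  equation.\<close>

lemma dissipative_resolvent:
  fixes A :: "real^'n^'n"
  assumes "\<And>x. x \<bullet> (A *v x) \<le> 0"
  obtains R where "\<And>x. R *v (x - A *v x) = x" "\<And>y. R *v y - A *v (R *v y) = y"
proof -
  have "x = 0" if "(mat 1 - A) *v x = 0" for x
  proof -
    have "A *v x = x" using that by (simp add: matrix_vector_mult_diff_rdistrib)
    then have "x \<bullet> x = 0" using assms[of x] by (intro antisym) simp_all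
    then show ?thesis by simp
  qed
  then obtain R where "R ** (mat 1 - A) = mat 1"
    using matrix_left_invertible_ker[of "mat 1 - A"] by blast
  moreover from this have "(mat 1 - A) ** R = mat 1" by (simp add: matrix_left_right_inverse)
  ultimately have "R *v ((mat 1 - A) *v x) = x" "(mat 1 - A) *v (R *v x) = x" for x
    by (simp_all add: matrix_vector_mul_assoc)
  then show ?thesis by (intro that[of R]) (simp_all add: matrix_vector_mult_diff_rdistrib)
qed

lemma nonpos_inner_nonneg:
  fixes z p :: "real^'m"
  assumes "\<And>i. z $ i \<le> 0" "\<And>i. 0 \<le> p $ i"
  shows "z \<bullet> p \<le> 0"
  using assms by (auto simp: inner_vec_def intro!: sum_nonpos mult_nonpos_nonneg)

text \<open>Solve the problem with D replaced by D + \<epsilon> I. The dissipation inequality, compared with a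
  feasible point, bounds \<epsilon> |z|^2, so the perturbation \<epsilon> z tends to 0 and closedness applies.\<close>
lemma passive_resolvent_surjective:
  fixes A :: "real^'n^'n" and B :: "real^'m^'n" and C :: "real^'n^'m" and D :: "real^'m^'m"
  assumes lmi: "\<And>x z. x \<bullet> (A *v x + B *v z) \<le> z \<bullet> (C *v x + D *v z)"
    and p0: "\<And>i. 0 \<le> (C *v x\<^sub>0 + v - D *v z\<^sub>0) $ i" and z0: "\<And>i. z\<^sub>0 $ i \<le> 0"
  obtains x z where "z \<in> P_plus_D_inv D (C *v x + v)" "y = x - A *v x + B *v z"
proof -
  have "x \<bullet> (A *v x) \<le> 0" for x using lmi[of x 0] by simp
  then obtain R where R: "\<And>x. R *v (x - A *v x) = x" "\<And>y. R *v y - A *v (R *v y) = y"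
    using dissipative_resolvent by blast
  \<comment> \<open>Substituting x = R (y - B z) leaves a complementarity problem in z alone, with
    matrix \<open>M\<close> and datum \<open>q\<close>.\<close>
  define M where "M = D + C ** R ** B"
  have M: "M *v z = D *v z + C *v (R *v (B *v z))" for z
    by (simp add: M_def matrix_vector_mult_add_rdistrib flip: matrix_vector_mul_assoc)
  have M_psd: "0 \<le> z \<bullet> (M *v z)" for z
  proof -
    let ?x = "R *v (B *v z)"
    \<comment> \<open>At this state the velocity equals the state, so the left side of the
      dissipation inequality is the square of \<open>norm ?x\<close>.\<close>
    have "A *v ?x + B *v z = ?x" using R(2)[of "B *v z"] by (simp add: algebra_simps)
    then have "?x \<bullet> ?x \<le> z \<bullet> (M *v z)" using lmi[of ?x z] by (simp add: M add.commute)
    then show ?thesis using inner_ge_zero[of ?x] by linarith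
  qed
  define q where "q = C *v (R *v y) + v"
  define w where "w = y - (x\<^sub>0 - A *v x\<^sub>0 + B *v z\<^sub>0)"
  define p\<^sub>0 where "p\<^sub>0 = C *v x\<^sub>0 + v - D *v z\<^sub>0"
  \<comment> \<open>A bound independent of \<epsilon>: \<open>w\<close> is the residual of the
    reference pair in the resolvent equation, and the mixed terms \<open>dx \<bullet> w\<close> and
    \<open>z\<^sub>0 \<bullet> z\<close> are absorbed by Young's inequality. The reference pair
    satisfies the sign conditions without being assumed complementary, whence the last term, which
    is nonnegative.\<close>
  define K where "K = 2 * (w \<bullet> w) + z\<^sub>0 \<bullet> z\<^sub>0 - 2 * (z\<^sub>0 \<bullet> p\<^sub>0)"
  have reg: "\<exists>z. z \<in> P_plus_D_inv M (q - \<epsilon> *\<^sub>R z) \<and> \<epsilon> * (z \<bullet> z) \<le> K" if \<epsilon>: "0 < \<epsilon>" "\<epsilon> \<le> 1" for \<epsilon>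
  proof -
    have "\<epsilon> * (z \<bullet> z) \<le> z \<bullet> ((M + \<epsilon> *\<^sub>R mat 1) *v z)" for z
      using M_psd[of z] by (simp add: matrix_vector_mult_add_rdistrib scaleR_matrix_vector_assoc[symmetric] inner_add_right)
    then obtain z where z: "z \<in> P_plus_D_inv (M + \<epsilon> *\<^sub>R mat 1) q"
      using P_plus_D_inv_strongly_monotone[OF \<epsilon>(1)] by blast
    define p where "p = q - \<epsilon> *\<^sub>R z - M *v z"
    have p_eq: "q - (M + \<epsilon> *\<^sub>R mat 1) *v z = p"
      by (simp add: p_def matrix_vector_mult_add_rdistrib scaleR_matrix_vector_assoc[symmetric] algebra_simps)
    have p: "0 \<le> p $ i" "z $ i \<le> 0" "p $ i = 0 \<or> z $ i = 0" for i
      using z unfolding mem_P_plus_D_inv p_eq by auto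
    have mem: "z \<in> P_plus_D_inv M (q - \<epsilon> *\<^sub>R z)"
      using p by (simp add: mem_P_plus_D_inv p_def)
    have zp: "z \<bullet> p = 0"
    proof -
      have "z $ i * p $ i = 0" for i using p(3)[of i] by auto
      then show ?thesis unfolding inner_vec_def inner_real_def by (intro sum.neutral) blast
    qed
    define x where "x = R *v (y - B *v z)"
    define dx where "dx = x - x\<^sub>0"
    define dz where "dz = z - z\<^sub>0"
    have x: "x - A *v x = y - B *v z" unfolding x_def by (rule R(2))
    have Cx: "C *v x + v - D *v z = p + \<epsilon> *\<^sub>R z"
      by (simp add: x_def p_def q_def M matrix_vector_mult_diff_distrib algebra_simps)
    have "A *v dx + B *v (- dz) = dx - w"
      using x by (simp add: dx_def dz_def w_def matrix_vector_mult_diff_distrib vec.neg algebra_simps)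
    moreover have "C *v dx + D *v (- dz) = (p + \<epsilon> *\<^sub>R z) - p\<^sub>0"
      unfolding Cx[symmetric] by (simp add: dx_def dz_def p\<^sub>0_def matrix_vector_mult_diff_distrib vec.neg algebra_simps)
    ultimately have "dx \<bullet> (dx - w) \<le> (- dz) \<bullet> ((p + \<epsilon> *\<^sub>R z) - p\<^sub>0)"
      using lmi[of dx "- dz"] by simp
    also have "\<dots> = - (\<epsilon> * (z \<bullet> z)) + z \<bullet> p\<^sub>0 + z\<^sub>0 \<bullet> p + \<epsilon> * (z\<^sub>0 \<bullet> z) - z\<^sub>0 \<bullet> p\<^sub>0"
      using zp by (simp add: dz_def algebra_simps)
    \<comment> \<open>The cross terms \<open>z \<bullet> p\<^sub>0\<close> and
      \<open>z\<^sub>0 \<bullet> p\<close> pair a nonpositive with a nonnegative vector and are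
      dropped.\<close>
    also have "\<dots> \<le> - (\<epsilon> * (z \<bullet> z)) + \<epsilon> * (z\<^sub>0 \<bullet> z) - z\<^sub>0 \<bullet> p\<^sub>0"
      using nonpos_inner_nonneg[OF p(2) p0] nonpos_inner_nonneg[OF z0 p(1)] by (simp add: p\<^sub>0_def)
    finally have 1: "dx \<bullet> dx - dx \<bullet> w \<le> - (\<epsilon> * (z \<bullet> z)) + \<epsilon> * (z\<^sub>0 \<bullet> z) - z\<^sub>0 \<bullet> p\<^sub>0"
      by (simp add: inner_diff_right)
    have "0 \<le> (dx - w) \<bullet> (dx - w)" by simp
    then have 2: "2 * (dx \<bullet> w) \<le> dx \<bullet> dx + w \<bullet> w"
      by (simp add: inner_diff_left inner_diff_right inner_commute)
    have "0 \<le> (z - z\<^sub>0) \<bullet> (z - z\<^sub>0)" by simp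
    then have "2 * (z\<^sub>0 \<bullet> z) \<le> z \<bullet> z + z\<^sub>0 \<bullet> z\<^sub>0"
      by (simp add: inner_diff_left inner_diff_right inner_commute)
    from mult_left_mono[OF this, of \<epsilon>] \<epsilon>
    have 3: "2 * (\<epsilon> * (z\<^sub>0 \<bullet> z)) \<le> \<epsilon> * (z \<bullet> z) + \<epsilon> * (z\<^sub>0 \<bullet> z\<^sub>0)" by (simp add: algebra_simps)
    have 4: "\<epsilon> * (z\<^sub>0 \<bullet> z\<^sub>0) \<le> z\<^sub>0 \<bullet> z\<^sub>0" using \<epsilon> by (simp add: mult_left_le_one_le)
    have "\<epsilon> * (z \<bullet> z) \<le> K"
      using 1 2 3 4 inner_ge_zero[of dx] inner_ge_zero[of w] unfolding K_def by linarith
    then show ?thesis using mem by blast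
  qed
  define \<epsilon> where "\<epsilon> l = 1 / real (Suc l)" for l
  have \<epsilon>: "0 < \<epsilon> l" "\<epsilon> l \<le> 1" for l by (auto simp: \<epsilon>_def)
  have "\<forall>l. \<exists>z. z \<in> P_plus_D_inv M (q - \<epsilon> l *\<^sub>R z) \<and> \<epsilon> l * (z \<bullet> z) \<le> K"
    using reg[OF \<epsilon>] by blast
  then obtain z where z: "\<And>l. z l \<in> P_plus_D_inv M (q - \<epsilon> l *\<^sub>R z l)" "\<And>l. \<epsilon> l * (z l \<bullet> z l) \<le> K"
    by metis
  have "norm (\<epsilon> l *\<^sub>R z l) \<le> sqrt (K * \<epsilon> l)" for l
  proof (rule real_le_rsqrt)
    have "(norm (\<epsilon> l *\<^sub>R z l))\<^sup>2 = (\<epsilon> l * (z l \<bullet> z l)) * \<epsilon> l"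
      by (simp add: power_mult_distrib power2_norm_eq_inner) (simp add: power2_eq_square)
    also have "\<dots> \<le> K * \<epsilon> l" using z(2) \<epsilon>(1) by (intro mult_right_mono) (auto intro: less_imp_le)
    finally show "(norm (\<epsilon> l *\<^sub>R z l))\<^sup>2 \<le> K * \<epsilon> l" .
  qed
  then have le: "\<forall>\<^sub>F l in sequentially. norm (\<epsilon> l *\<^sub>R z l) \<le> sqrt (K * \<epsilon> l)" by simp
  have "\<epsilon> \<longlonglongrightarrow> 0" unfolding \<epsilon>_def by (rule LIMSEQ_Suc[OF lim_1_over_n])
  then have "(\<lambda>l. sqrt (K * \<epsilon> l)) \<longlonglongrightarrow> sqrt (K * 0)"
    by (intro tendsto_real_sqrt tendsto_mult_left)
  then have "(\<lambda>l. sqrt (K * \<epsilon> l)) \<longlonglongrightarrow> 0" by simp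
  with le have "(\<lambda>l. \<epsilon> l *\<^sub>R z l) \<longlonglongrightarrow> 0" by (rule Lim_null_comparison)
  then have q: "(\<lambda>l. q - \<epsilon> l *\<^sub>R z l) \<longlonglongrightarrow> q" using tendsto_diff[OF tendsto_const] by force
  \<comment> \<open>The output matrix is taken to be 0: any solution for the limiting datum
    \<open>q\<close> will do, and no convergence of \<open>B *v z l\<close> has been
    established.\<close>
  have "(\<lambda>l. (0 :: real^'m^'m) *v z l) \<longlonglongrightarrow> 0" by simp
  from P_plus_D_inv_closed[OF z(1) q this] obtain z\<^sub>1 where z1: "z\<^sub>1 \<in> P_plus_D_inv M q"
    by blast
  define x where "x = R *v (y - B *v z\<^sub>1)"
  have "C *v x + v - D *v z\<^sub>1 = q - M *v z\<^sub>1"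
    by (simp add: x_def q_def M matrix_vector_mult_diff_distrib algebra_simps)
  then have "z\<^sub>1 \<in> P_plus_D_inv D (C *v x + v)" using z1 unfolding mem_P_plus_D_inv by metis
  moreover have "y = x - A *v x + B *v z\<^sub>1" unfolding x_def R(2) by simp
  ultimately show ?thesis by (rule that)
qed

text \<open>This is the resolvent equation with A = B = C = 0, where the state decouples and the
  dissipation inequality reduces to positive semidefiniteness of D. It makes the complementarity
  condition irrelevant for membership in the domain of H.\<close>

lemma P_plus_D_inv_nonempty_if_feasible:
  fixes D :: "real^'m^'m"
  assumes "\<And>z. 0 \<le> z \<bullet> (D *v z)" "\<And>i. 0 \<le> (\<eta> - D *v z\<^sub>0) $ i" "\<And>i. z\<^sub>0 $ i \<le> 0"
  obtains z where "z \<in> P_plus_D_inv D \<eta>"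
proof (rule passive_resolvent_surjective)
  show "x \<bullet> ((0 :: real^'m^'m) *v x + (0 :: real^'m^'m) *v z) \<le> z \<bullet> ((0 :: real^'m^'m) *v x + D *v z)" for x z
    using assms(1) by simp
  show "0 \<le> ((0 :: real^'m^'m) *v 0 + \<eta> - D *v z\<^sub>0) $ i" for i using assms(2) by simp
  show thesis if "z \<in> P_plus_D_inv D ((0 :: real^'m^'m) *v x + \<eta>)" for x z
    using that \<open>\<And>z. z \<in> P_plus_D_inv D \<eta> \<Longrightarrow> thesis\<close> by simp
qed (rule assms(3))

subsection \<open>Variation of absolutely continuous functions\<close>

text \<open>Reindexing the families of intervals by an arbitrary finite set allows index sets of
  pairs, as arise when each interval of a family is itself partitioned.\<close>

lemma abs_continuous_onD:
  assumes "abs_continuous_on S f" "\<epsilon> > 0"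
  shows "\<exists>\<delta>>0. \<forall>(J::'j set) a b. finite J \<and> (\<forall>j\<in>J. a j \<le> b j \<and> {a j..b j} \<subseteq> S) \<and>
       (\<forall>i\<in>J. \<forall>j\<in>J. i \<noteq> j \<longrightarrow> b i \<le> a j \<or> b j \<le> a i) \<and> (\<Sum>j\<in>J. b j - a j) < \<delta>
       \<longrightarrow> (\<Sum>j\<in>J. norm (f (b j) - f (a j))) < \<epsilon>"
proof -
  obtain \<delta> where \<delta>: "\<delta> > 0" "\<forall>(n::nat) a b.
        (\<forall>i<n. a i \<le> b i \<and> {a i..b i} \<subseteq> S) \<and>
        (\<forall>i<n. \<forall>j<n. i \<noteq> j \<longrightarrow> b i \<le> a j \<or> b j \<le> a i) \<and>
        (\<Sum>i<n. b i - a i) < \<delta>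
        \<longrightarrow> (\<Sum>i<n. norm (f (b i) - f (a i))) < \<epsilon>"
    using assms unfolding abs_continuous_on_def by blast
  show ?thesis
  proof (intro exI conjI allI impI, rule \<delta>(1), elim conjE)
    fix J :: "'j set" and a b
    assume J: "finite J" "\<forall>j\<in>J. a j \<le> b j \<and> {a j..b j} \<subseteq> S"
       "\<forall>i\<in>J. \<forall>j\<in>J. i \<noteq> j \<longrightarrow> b i \<le> a j \<or> b j \<le> a i" "(\<Sum>j\<in>J. b j - a j) < \<delta>"
    obtain h where h: "bij_betw h {..<card J} J"
      using ex_bij_betw_nat_finite[OF J(1)] by (auto simp: atLeast0LessThan)
    have reindex: "(\<Sum>i<card J. g (h i)) = (\<Sum>j\<in>J. g j)" for g :: "'j \<Rightarrow> real"
      using h by (rule sum.reindex_bij_betw)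
    have hJ: "h i \<in> J" if "i < card J" for i using h that by (auto simp: bij_betw_def)
    have hinj: "h i \<noteq> h j" if "i < card J" "j < card J" "i \<noteq> j" for i j
      using h that by (auto simp: bij_betw_def inj_on_def)
    have "(\<Sum>i<card J. norm (f ((b \<circ> h) i) - f ((a \<circ> h) i))) < \<epsilon>"
    proof (rule \<delta>(2)[rule_format], intro conjI allI impI)
      show "(\<Sum>i<card J. (b \<circ> h) i - (a \<circ> h) i) < \<delta>"
        using J(4) reindex[of "\<lambda>j. b j - a j"] by simp
    qed (use J(2,3) hJ hinj in auto)
    then show "(\<Sum>j\<in>J. norm (f (b j) - f (a j))) < \<epsilon>"
      using reindex[of "\<lambda>j. norm (f (b j) - f (a j))"] by simp
  qed
qed

section \<open>Total variation through monotone sequences of points\<close>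

definition variation_sum :: "(real \<Rightarrow> 'a::real_normed_vector) \<Rightarrow> nat \<Rightarrow> (nat \<Rightarrow> real) \<Rightarrow> real" where
  "variation_sum f n p = (\<Sum>i<n. norm (f (p (Suc i)) - f (p i)))"

text \<open>A partition is a monotone sequence on all naturals, of which the first \<open>n\<close>
  increments count. Repeated points are allowed and the endpoints need not occur, so clipping a
  sequence at a point gives a partition again.\<close>

definition variation_sums :: "(real \<Rightarrow> 'a::real_normed_vector) \<Rightarrow> real \<Rightarrow> real \<Rightarrow> real set" where
  "variation_sums f s t = {variation_sum f n p | n p. mono p \<and> range p \<subseteq> {s..t}}"

definition variation_on :: "(real \<Rightarrow> 'a::real_normed_vector) \<Rightarrow> real \<Rightarrow> real \<Rightarrow> real" where
  "variation_on f s t = Sup (variation_sums f s t)"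

lemma variation_sumsI:
  "\<lbrakk>mono p; range p \<subseteq> {s..t}\<rbrakk> \<Longrightarrow> variation_sum f n p \<in> variation_sums f s t"
  by (auto simp: variation_sums_def)

lemma variation_sums_nonempty:
  assumes "s \<le> t" shows "variation_sums f s t \<noteq> {}"
proof -
  have "variation_sum f 0 (\<lambda>_. s) \<in> variation_sums f s t"
    using assms by (intro variation_sumsI) (auto simp: mono_def)
  then show ?thesis by blast
qed

lemma variation_sums_mono:
  "\<lbrakk>s \<le> s'; t' \<le> t\<rbrakk> \<Longrightarrow> variation_sums f s' t' \<subseteq> variation_sums f s t"
  by (fastforce simp: variation_sums_def)

text \<open>An increment that crosses \<open>s\<close> is split there by the triangle inequality.
  One that stays on a single side becomes constant in the other clipped sequence and contributes 0
  to it.\<close>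

lemma variation_sum_split:
  "variation_sum f n p \<le> variation_sum f n (\<lambda>i. min (p i) s) + variation_sum f n (\<lambda>i. max (p i) s)"
  unfolding variation_sum_def sum.distrib[symmetric]
proof (rule sum_mono)
  fix i
  have "norm (f u - f w) \<le> norm (f (min u s) - f (min w s)) + norm (f (max u s) - f (max w s))" for u w
    using norm_triangle_ineq[of "f u - f s" "f s - f w"]
    by (cases "u \<le> s"; cases "w \<le> s") (auto simp: min_def max_def)
  then show "norm (f (p (Suc i)) - f (p i)) \<le> norm (f (min (p (Suc i)) s) - f (min (p i) s)) +
      norm (f (max (p (Suc i)) s) - f (max (p i) s))" .
qed

lemma mono_clip:
  assumes "mono (p :: nat \<Rightarrow> real)"
  shows "mono (\<lambda>i. min (p i) s)" "mono (\<lambda>i. max (p i) s)"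
  using assms by (auto simp: mono_def min_def max_def intro: order_trans)

text \<open>On a window shorter than the \<delta> belonging to tolerance 1, every partition sum is
  at most 1, and finitely many such windows cover the interval.\<close>

lemma abs_continuous_on_variation_bdd:
  assumes "abs_continuous_on {a..b} f" "a \<le> b"
  shows "bdd_above (variation_sums f a b)"
proof -
  obtain \<delta> where \<delta>: "\<delta> > 0" "\<forall>(J::nat set) u w. finite J \<and> (\<forall>j\<in>J. u j \<le> w j \<and> {u j..w j} \<subseteq> {a..b}) \<and>
       (\<forall>i\<in>J. \<forall>j\<in>J. i \<noteq> j \<longrightarrow> w i \<le> u j \<or> w j \<le> u i) \<and> (\<Sum>j\<in>J. w j - u j) < \<delta>
       \<longrightarrow> (\<Sum>j\<in>J. norm (f (w j) - f (u j))) < 1"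
    using abs_continuous_onD[OF assms(1) zero_less_one, where 'j = nat] by blast
  have small: "variation_sum f n p \<le> 1"
    if p: "mono p" "range p \<subseteq> {s..t}" and st: "a \<le> s" "t \<le> b" "t - s < \<delta>" for n p s t
    unfolding variation_sum_def
  proof (rule less_imp_le, intro \<delta>(2)[rule_format] conjI ballI impI)
    have "p i \<in> {s..t}" for i using p by blast
    then have pi: "s \<le> p i" "p i \<le> t" for i by auto
    have "(\<Sum>i<n. p (Suc i) - p i) = p n - p 0" by (rule sum_lessThan_telescope)
    then show "(\<Sum>i<n. p (Suc i) - p i) < \<delta>" using pi(1)[of 0] pi(2)[of n] st by linarith
    show "p j \<le> p (Suc j)" "{p j..p (Suc j)} \<subseteq> {a..b}" for j
      using p(1) pi(1)[of j] pi(2)[of "Suc j"] st by (auto simp: mono_def)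
    show "p (Suc i) \<le> p j \<or> p (Suc j) \<le> p i" if "i \<noteq> j" for i j
      using p(1) that by (metis Suc_leI linorder_neqE_nat monoD)
  qed auto
  \<comment> \<open>Each further window of length \<delta>/2, strictly below \<delta>, adds at most
    1. The \<open>min b\<close> keeps the last window inside the interval.\<close>
  have "variation_sum f n p \<le> real k" if "mono p" "range p \<subseteq> {a..min b (a + real k * (\<delta>/2))}" for k n p
    using that
  proof (induction k arbitrary: p)
    case 0
    then have "p i = a" for i using assms(2) by (auto simp: subset_iff image_iff antisym)
    then show ?case by (simp add: variation_sum_def)
  next
    case (Suc k)
    let ?s = "min b (a + real k * (\<delta>/2))"
    have pi: "a \<le> p i" "p i \<le> min b (a + real (Suc k) * (\<delta>/2))" for i
      using Suc.prems(2) by (auto simp: subset_iff image_iff)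
    have as: "a \<le> ?s" using assms(2) \<delta>(1) by simp
    have "variation_sum f n (\<lambda>i. min (p i) ?s) \<le> real k"
      using as pi(1) by (intro Suc.IH mono_clip Suc.prems(1)) auto
    moreover have "variation_sum f n (\<lambda>i. max (p i) ?s) \<le> 1"
    proof (rule small)
      show "range (\<lambda>i. max (p i) ?s) \<subseteq> {?s..min b (a + real (Suc k) * (\<delta>/2))}"
        using pi \<delta>(1) by (auto simp: algebra_simps min.coboundedI2)
      show "min b (a + real (Suc k) * (\<delta>/2)) - ?s < \<delta>"
        using \<delta>(1) by (auto simp: min_def field_simps)
    qed (use as Suc.prems(1) mono_clip in auto)
    ultimately show ?case using variation_sum_split[of f n p ?s] by simp
  qed
  moreover obtain k :: nat where "(b - a) / (\<delta>/2) \<le> real k" using real_arch_simple by blast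
  then have "b \<le> a + real k * (\<delta>/2)" using \<delta>(1) by (simp add: field_simps)
  then have "min b (a + real k * (\<delta>/2)) = b" by simp
  ultimately show ?thesis
    by (intro bdd_aboveI[of _ "real k"]) (auto simp: variation_sums_def)
qed

locale finite_variation =
  fixes f :: "real \<Rightarrow> 'a::real_normed_vector" and a b :: real
  assumes ab: "a \<le> b" and bdd: "bdd_above (variation_sums f a b)"
begin

lemma bdd_sub: "\<lbrakk>a \<le> s; t \<le> b\<rbrakk> \<Longrightarrow> bdd_above (variation_sums f s t)"
  using bdd variation_sums_mono bdd_above_mono by metis

lemma variation_sum_le:
  "\<lbrakk>a \<le> s; t \<le> b; mono p; range p \<subseteq> {s..t}\<rbrakk> \<Longrightarrow> variation_sum f n p \<le> variation_on f s t"
  unfolding variation_on_def by (intro cSup_upper variation_sumsI bdd_sub)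

lemma variation_extend:
  assumes "a \<le> s" "s \<le> t" "t \<le> b"
  shows "variation_on f a s + norm (f t - f s) \<le> variation_on f a t"
proof -
  have "variation_sum f n p \<le> variation_on f a t - norm (f t - f s)"
    if p: "mono p" "range p \<subseteq> {a..s}" for n p
  proof -
    \<comment> \<open>Two increments are appended: from \<open>p n\<close> to \<open>s\<close>,
      which is nonnegative and discarded, and from \<open>s\<close> to \<open>t\<close>.\<close>
    define p' where "p' i = (if i \<le> n then p i else if i = Suc n then s else t)" for i
    have pi: "a \<le> p i" "p i \<le> s" for i using p(2) by (auto simp: subset_iff image_iff)
    have "mono p'"
      using p(1) pi(2) assms by (auto simp: p'_def mono_def intro: order_trans)
    moreover have "range p' \<subseteq> {a..t}"
      using pi order_trans[OF pi(2) assms(2)] assms by (auto simp: p'_def)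
    ultimately have "variation_sum f (Suc (Suc n)) p' \<le> variation_on f a t"
      using assms by (intro variation_sum_le) auto
    moreover have "variation_sum f n p' = variation_sum f n p"
      unfolding variation_sum_def by (intro sum.cong) (auto simp: p'_def)
    then have "variation_sum f (Suc (Suc n)) p' = variation_sum f n p + norm (f s - f (p n)) + norm (f t - f s)"
      by (simp add: variation_sum_def p'_def)
    ultimately show ?thesis using norm_ge_zero[of "f s - f (p n)"] by linarith
  qed
  then have "variation_on f a s \<le> variation_on f a t - norm (f t - f s)"
    unfolding variation_on_def[of f a s] using assms
    by (intro cSup_least variation_sums_nonempty) (auto simp: variation_sums_def)
  then show ?thesis by simp
qed

lemma variation_subadditive:
  assumes "a \<le> s" "s \<le> t" "t \<le> b"
  shows "variation_on f a t \<le> variation_on f a s + variation_on f s t"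
  unfolding variation_on_def[of f a t]
proof (rule cSup_least)
  show "variation_sums f a t \<noteq> {}" using assms by (intro variation_sums_nonempty) auto
  fix x assume "x \<in> variation_sums f a t"
  then obtain n p where x: "x = variation_sum f n p" and p: "mono p" "range p \<subseteq> {a..t}"
    by (auto simp: variation_sums_def)
  have pi: "a \<le> p i" "p i \<le> t" for i using p(2) by (auto simp: subset_iff image_iff)
  have "variation_sum f n (\<lambda>i. min (p i) s) \<le> variation_on f a s"
    using assms pi by (intro variation_sum_le mono_clip p) auto
  moreover have "variation_sum f n (\<lambda>i. max (p i) s) \<le> variation_on f s t"
    using assms pi by (intro variation_sum_le mono_clip p) auto
  ultimately show "x \<le> variation_on f a s + variation_on f s t"
    using variation_sum_split[of f n p s] x by linarith
qed

end

text \<open>Replacing each interval by a nearly optimal partition of it turns a short family of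
  intervals into another one, whose increments add up to nearly the sum of the variations.\<close>
lemma abs_continuous_on_variation:
  assumes ac: "abs_continuous_on {a..b} f" and "a \<le> b"
  shows "abs_continuous_on {a..b} (variation_on f a)"
  unfolding abs_continuous_on_def
proof (intro allI impI)
  interpret finite_variation f a b
    using assms abs_continuous_on_variation_bdd by unfold_locales
  fix \<epsilon> :: real assume "\<epsilon> > 0"
  then have half: "\<epsilon> / 2 > 0" by simp
  obtain \<delta> where \<delta>: "\<delta> > 0" "\<forall>(J::(nat \<times> nat) set) u w. finite J \<and> (\<forall>j\<in>J. u j \<le> w j \<and> {u j..w j} \<subseteq> {a..b}) \<and>
       (\<forall>i\<in>J. \<forall>j\<in>J. i \<noteq> j \<longrightarrow> w i \<le> u j \<or> w j \<le> u i) \<and> (\<Sum>j\<in>J. w j - u j) < \<delta>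
       \<longrightarrow> (\<Sum>j\<in>J. norm (f (w j) - f (u j))) < \<epsilon> / 2"
    using abs_continuous_onD[OF ac half, where 'j = "nat \<times> nat"] by blast
  show "\<exists>\<delta>>0. \<forall>(n::nat) u w.
        (\<forall>i<n. u i \<le> w i \<and> {u i..w i} \<subseteq> {a..b}) \<and>
        (\<forall>i<n. \<forall>j<n. i \<noteq> j \<longrightarrow> w i \<le> u j \<or> w j \<le> u i) \<and> (\<Sum>i<n. w i - u i) < \<delta> \<longrightarrow>
        (\<Sum>i<n. norm (variation_on f a (w i) - variation_on f a (u i))) < \<epsilon>"
  proof (intro exI conjI allI impI, rule \<delta>(1), elim conjE)
    fix n :: nat and u w
    assume uw: "\<forall>i<n. u i \<le> w i \<and> {u i..w i} \<subseteq> {a..b}"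
      and ov: "\<forall>i<n. \<forall>j<n. i \<noteq> j \<longrightarrow> w i \<le> u j \<or> w j \<le> u i" and len: "(\<Sum>i<n. w i - u i) < \<delta>"
    have uw': "a \<le> u i" "u i \<le> w i" "w i \<le> b" if "i < n" for i using uw that by auto
    \<comment> \<open>The \<open>n\<close> losses of \<open>\<eta>\<close> add up to at most
      \<epsilon>/2; the extra 1 covers \<open>n = 0\<close>. The other half is spent on the
      partition sums.\<close>
    define \<eta> where "\<eta> = \<epsilon> / (2 * (real n + 1))"
    have \<eta>: "\<eta> > 0" using \<open>\<epsilon> > 0\<close> by (simp add: \<eta>_def)
    have "\<forall>i\<in>{..<n}. \<exists>m p. mono p \<and> range p \<subseteq> {u i..w i} \<and> variation_on f (u i) (w i) - \<eta> < variation_sum f m p"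
    proof
      fix i assume "i \<in> {..<n}"
      then have i: "i < n" by simp
      have "variation_on f (u i) (w i) - \<eta> < Sup (variation_sums f (u i) (w i))"
        using \<eta> by (simp add: variation_on_def)
      then obtain x where "x \<in> variation_sums f (u i) (w i)" "variation_on f (u i) (w i) - \<eta> < x"
        using less_cSupD[OF variation_sums_nonempty[OF uw'(2)[OF i]]] by blast
      then show "\<exists>m p. mono p \<and> range p \<subseteq> {u i..w i} \<and> variation_on f (u i) (w i) - \<eta> < variation_sum f m p"
        by (auto simp: variation_sums_def)
    qed
    then obtain m where "\<forall>i\<in>{..<n}. \<exists>p. mono p \<and> range p \<subseteq> {u i..w i} \<and>
        variation_on f (u i) (w i) - \<eta> < variation_sum f (m i) p"
      by (rule bchoice[THEN exE]) blast
    then obtain p where p: "\<forall>i\<in>{..<n}. mono (p i) \<and> range (p i) \<subseteq> {u i..w i} \<and>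
        variation_on f (u i) (w i) - \<eta> < variation_sum f (m i) (p i)"
      by (rule bchoice[THEN exE]) blast
    have mp: "mono (p i)" "range (p i) \<subseteq> {u i..w i}"
      "variation_on f (u i) (w i) - \<eta> < variation_sum f (m i) (p i)" if "i < n" for i
      using p that by auto
    have pi: "u i \<le> p i k" "p i k \<le> w i" if "i < n" for i k
      using mp(2)[OF that] by (auto simp: subset_iff image_iff)
    \<comment> \<open>The index (i, k) names the k-th piece of the i-th interval. For fixed i the
      lengths telescope, so the refined family is no longer in total than the original one.\<close>
    define J where "J = Sigma {..<n} (\<lambda>i. {..<m i})"
    have sumJ: "(\<Sum>j\<in>J. g (fst j) (snd j)) = (\<Sum>i<n. \<Sum>k<m i. g i k)" for g :: "nat \<Rightarrow> nat \<Rightarrow> real"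
      unfolding J_def by (subst sum.Sigma) (auto simp: case_prod_unfold)
    have "(\<Sum>j\<in>J. norm (f (p (fst j) (Suc (snd j))) - f (p (fst j) (snd j)))) < \<epsilon> / 2"
    proof (intro \<delta>(2)[rule_format] conjI ballI impI)
      show "finite J" by (simp add: J_def)
      show "p (fst j) (snd j) \<le> p (fst j) (Suc (snd j))" "{p (fst j) (snd j)..p (fst j) (Suc (snd j))} \<subseteq> {a..b}"
        if "j \<in> J" for j
      proof -
        have i: "fst j < n" using that by (auto simp: J_def)
        show "p (fst j) (snd j) \<le> p (fst j) (Suc (snd j))" "{p (fst j) (snd j)..p (fst j) (Suc (snd j))} \<subseteq> {a..b}"
          using monoD[OF mp(1)[OF i], of "snd j" "Suc (snd j)"] pi(1)[OF i, of "snd j"]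
            pi(2)[OF i, of "Suc (snd j)"] uw'[OF i] by auto
      qed
      show "p (fst i) (Suc (snd i)) \<le> p (fst j) (snd j) \<or> p (fst j) (Suc (snd j)) \<le> p (fst i) (snd i)"
        if "i \<in> J" "j \<in> J" "i \<noteq> j" for i j
      proof -
        have ij: "fst i < n" "fst j < n" using that by (auto simp: J_def)
        show ?thesis
        proof (cases "fst i = fst j")
          case True
          then have "snd i \<noteq> snd j" using that(3) by (simp add: prod_eq_iff)
          then consider "Suc (snd i) \<le> snd j" | "Suc (snd j) \<le> snd i" by linarith
          then show ?thesis using True monoD[OF mp(1)[OF ij(1)]] by cases auto
        next
          case False
          then have "w (fst i) \<le> u (fst j) \<or> w (fst j) \<le> u (fst i)" using ov ij by blast
          then show ?thesis using pi[OF ij(1)] pi[OF ij(2)] by (meson order_trans)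
        qed
      qed
      have "(\<Sum>j\<in>J. p (fst j) (Suc (snd j)) - p (fst j) (snd j)) = (\<Sum>i<n. \<Sum>k<m i. p i (Suc k) - p i k)"
        by (rule sumJ)
      also have "\<dots> \<le> (\<Sum>i<n. w i - u i)"
        unfolding sum_lessThan_telescope using pi by (intro sum_mono diff_mono) auto
      finally show "(\<Sum>j\<in>J. p (fst j) (Suc (snd j)) - p (fst j) (snd j)) < \<delta>" using len by simp
    qed
    then have small: "(\<Sum>i<n. variation_sum f (m i) (p i)) < \<epsilon> / 2"
      unfolding sumJ[of "\<lambda>i k. norm (f (p i (Suc k)) - f (p i k))"] variation_sum_def .
    have "norm (variation_on f a (w i) - variation_on f a (u i)) \<le> variation_sum f (m i) (p i) + \<eta>" if i: "i < n" for i
      using variation_extend[OF uw'[OF i]] variation_subadditive[OF uw'[OF i]] mp(3)[OF i]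
        norm_ge_zero[of "f (w i) - f (u i)"] unfolding real_norm_def abs_le_iff by linarith
    then have "(\<Sum>i<n. norm (variation_on f a (w i) - variation_on f a (u i))) \<le> (\<Sum>i<n. variation_sum f (m i) (p i) + \<eta>)"
      by (intro sum_mono) auto
    also have "\<dots> = (\<Sum>i<n. variation_sum f (m i) (p i)) + real n * \<eta>" by (simp add: sum.distrib)
    also have "real n * \<eta> \<le> \<epsilon> / 2" using \<open>\<epsilon> > 0\<close> by (simp add: \<eta>_def field_simps)
    finally show "(\<Sum>i<n. norm (variation_on f a (w i) - variation_on f a (u i))) < \<epsilon>" using small by simp
  qed
qed

lemma abs_continuous_on_imp_continuous_on:
  assumes ac: "abs_continuous_on S f" and "is_interval S"
  shows "continuous_on S f"
  unfolding continuous_on_iff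
proof (intro ballI allI impI)
  fix t\<^sub>0 and e :: real assume t0: "t\<^sub>0 \<in> S" and e: "e > 0"
  obtain \<delta> where \<delta>: "\<delta> > 0" "\<forall>(J::nat set) a b. finite J \<and> (\<forall>j\<in>J. a j \<le> b j \<and> {a j..b j} \<subseteq> S) \<and>
       (\<forall>i\<in>J. \<forall>j\<in>J. i \<noteq> j \<longrightarrow> b i \<le> a j \<or> b j \<le> a i) \<and> (\<Sum>j\<in>J. b j - a j) < \<delta>
       \<longrightarrow> (\<Sum>j\<in>J. norm (f (b j) - f (a j))) < e"
    using abs_continuous_onD[OF ac e, where 'j = nat] by blast
  have main: "norm (f y - f x) < e" if "x \<in> S" "y \<in> S" "x \<le> y" "y - x < \<delta>" for x y
  proof -
    have "{x..y} \<subseteq> S"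
      using mem_is_interval_1_I[OF assms(2) that(1,2)] by auto
    then show ?thesis using \<delta>(2)[rule_format, of "{0}" "\<lambda>_. x" "\<lambda>_. y"] that by simp
  qed
  have "dist (f t) (f t\<^sub>0) < e" if "t \<in> S" "dist t t\<^sub>0 < \<delta>" for t
    using main[of t t\<^sub>0] main[of t\<^sub>0 t] that t0
    by (cases "t \<le> t\<^sub>0") (auto simp: dist_norm norm_minus_commute abs_if split: if_splits)
  then show "\<exists>d>0. \<forall>t\<in>S. dist t t\<^sub>0 < d \<longrightarrow> dist (f t) (f t\<^sub>0) < e" using \<delta>(1) by blast
qed

lemma abs_continuous_on_cmult:
  fixes f :: "real \<Rightarrow> real"
  assumes "abs_continuous_on S f"
  shows "abs_continuous_on S (\<lambda>t. c * f t)"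
  unfolding abs_continuous_on_def
proof (intro allI impI)
  fix \<epsilon> :: real assume "\<epsilon> > 0"
  \<comment> \<open>The added 1 keeps the divisor positive when \<open>c = 0\<close>.\<close>
  then have "\<epsilon> / (\<bar>c\<bar> + 1) > 0" by simp
  then obtain \<delta> where \<delta>: "\<delta> > 0" "\<forall>(n::nat) a b.
        (\<forall>i<n. a i \<le> b i \<and> {a i..b i} \<subseteq> S) \<and>
        (\<forall>i<n. \<forall>j<n. i \<noteq> j \<longrightarrow> b i \<le> a j \<or> b j \<le> a i) \<and>
        (\<Sum>i<n. b i - a i) < \<delta>
        \<longrightarrow> (\<Sum>i<n. norm (f (b i) - f (a i))) < \<epsilon> / (\<bar>c\<bar> + 1)"
    using assms unfolding abs_continuous_on_def by blast
  have "(\<Sum>i<n. norm (c * f (b i) - c * f (a i))) < \<epsilon>"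
    if "(\<Sum>i<n. norm (f (b i) - f (a i))) < \<epsilon> / (\<bar>c\<bar> + 1)" for n :: nat and a b
  proof -
    have "(\<Sum>i<n. norm (c * f (b i) - c * f (a i))) = \<bar>c\<bar> * (\<Sum>i<n. norm (f (b i) - f (a i)))"
      by (simp add: sum_distrib_left abs_mult flip: right_diff_distrib)
    also have "\<dots> \<le> (\<bar>c\<bar> + 1) * (\<Sum>i<n. norm (f (b i) - f (a i)))"
      by (intro mult_right_mono sum_nonneg) auto
    also have "\<dots> < \<epsilon>" using that by (simp add: field_simps)
    finally show ?thesis .
  qed
  with \<delta> show "\<exists>\<delta>>0. \<forall>(n::nat) a b.
        (\<forall>i<n. a i \<le> b i \<and> {a i..b i} \<subseteq> S) \<and>
        (\<forall>i<n. \<forall>j<n. i \<noteq> j \<longrightarrow> b i \<le> a j \<or> b j \<le> a i) \<and>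
        (\<Sum>i<n. b i - a i) < \<delta>
        \<longrightarrow> (\<Sum>i<n. norm (c * f (b i) - c * f (a i))) < \<epsilon>"
    by (intro exI[of _ \<delta>]) simp
qed

subsection \<open>Passivity and the dissipation inequality\<close>

text \<open>The solution is a power series in t. Comparing coefficients gives the recursion for
  \<open>c\<close>, in which the constant term \<open>b\<close> enters when passing from order 0 to
  order 1, and factorial decay of the coefficients makes the series converge everywhere.\<close>

lemma affine_ode_solution:
  fixes A :: "real^'n^'n" and b x\<^sub>0 :: "real^'n"
  obtains x where "x 0 = x\<^sub>0" "\<And>t. (x has_vector_derivative A *v x t + b) (at t)"
proof -
  define c where "c = rec_nat x\<^sub>0 (\<lambda>k y. (1 / real (Suc k)) *\<^sub>R (A *v y + (if k = 0 then b else 0)))"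
  have c0: "c 0 = x\<^sub>0" and
    cS: "c (Suc k) = (1 / real (Suc k)) *\<^sub>R (A *v c k + (if k = 0 then b else 0))" for k
    by (simp_all add: c_def)
  obtain L where L: "L > 0" "\<And>y. norm (A *v y) \<le> norm y * L"
    using bounded_linear.pos_bounded[OF matrix_vector_mul_bounded_linear[of A]] by blast
  \<comment> \<open>Chosen so that K L = |x0| L + |b|, which absorbs \<open>b\<close> in the first
    step of the induction.\<close>
  define K where "K = norm x\<^sub>0 + norm b / L"
  have bound: "norm (c k) \<le> K * (L ^ k / fact k)" for k
  proof (induction k)
    case 0
    then show ?case using L by (simp add: c0 K_def)
  next
    case (Suc k)
    have "norm (A *v c k + (if k = 0 then b else 0)) \<le> K * (L ^ k / fact k) * L"
    proof (cases "k = 0")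
      case True
      have "norm (A *v x\<^sub>0 + b) \<le> norm x\<^sub>0 * L + norm b"
        using L(2)[of x\<^sub>0] norm_triangle_ineq[of "A *v x\<^sub>0" b] by linarith
      also have "\<dots> = K * L" using L(1) by (simp add: K_def field_simps)
      finally show ?thesis using True by (simp add: c0)
    next
      case False
      then show ?thesis using L(2)[of "c k"] mult_right_mono[OF Suc.IH, of L] L(1) by simp
    qed
    from mult_left_mono[OF this, of "1 / real (Suc k)"]
    have "norm (c (Suc k)) \<le> 1 / real (Suc k) * (K * (L ^ k / fact k) * L)" by (simp add: cS)
    also have "\<dots> = K * (L ^ Suc k / fact (Suc k))" by (simp add: field_simps)
    finally show ?case .
  qed
  have summ: "summable (\<lambda>k. c k $ i * y ^ k)" for i and y :: real
  proof (rule summable_comparison_test')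
    show "summable (\<lambda>k. K * (inverse (fact k) * (L * \<bar>y\<bar>) ^ k))"
      by (intro summable_mult summable_exp)
    fix k :: nat
    have "norm (c k $ i * y ^ k) = \<bar>c k $ i\<bar> * \<bar>y\<bar> ^ k" by (simp add: abs_mult power_abs)
    also have "\<dots> \<le> (K * (L ^ k / fact k)) * \<bar>y\<bar> ^ k"
      using bound[of k] component_le_norm_cart[of "c k" i] by (intro mult_right_mono) auto
    also have "\<dots> = K * (inverse (fact k) * (L * \<bar>y\<bar>) ^ k)"
      by (simp add: power_mult_distrib field_simps)
    finally show "norm (c k $ i * y ^ k) \<le> K * (inverse (fact k) * (L * \<bar>y\<bar>) ^ k)" .
  qed
  define \<xi> where "\<xi> i t = (\<Sum>k. c k $ i * t ^ k)" for i t
  define x where "x t = (\<chi> i. \<xi> i t)" for t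
  have sums: "(\<lambda>k. c k $ i * t ^ k) sums \<xi> i t" for i t
    unfolding \<xi>_def by (intro summable_sums summ)
  have deriv: "(\<xi> i has_real_derivative (A *v x t + b) $ i) (at t)" for i t
  proof -
    have eq1: "diffs (\<lambda>k. c k $ i) k * t ^ k = (\<Sum>j\<in>UNIV. A $ i $ j * (c k $ j * t ^ k)) + (if k = 0 then b $ i else 0)" for k
    proof -
      have "diffs (\<lambda>k. c k $ i) k * t ^ k = ((A *v c k) $ i + (if k = 0 then b $ i else 0)) * t ^ k"
        by (simp add: diffs_def cS del: of_nat_Suc)
      also have "\<dots> = (A *v c k) $ i * t ^ k + (if k = 0 then b $ i else 0)"
        by (simp add: distrib_right)
      finally show ?thesis
        by (simp add: matrix_vector_mult_def sum_distrib_right mult.assoc)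
    qed
    have sm: "(\<lambda>k. (\<Sum>j\<in>UNIV. A $ i $ j * (c k $ j * t ^ k)) + (if k = 0 then b $ i else 0)) sums
        ((\<Sum>j\<in>UNIV. A $ i $ j * \<xi> j t) + b $ i)"
      using sums_single[of 0 "\<lambda>_. b $ i"] by (intro sums_add sums_sum sums_mult sums) auto
    have eq2: "(\<Sum>j\<in>UNIV. A $ i $ j * \<xi> j t) + b $ i = (A *v x t + b) $ i"
      by (simp add: x_def matrix_vector_mult_def)
    have "(\<Sum>k. diffs (\<lambda>k. c k $ i) k * t ^ k) = (A *v x t + b) $ i"
      unfolding eq1 using sums_unique[OF sm] eq2 by (simp only:)
    moreover have "((\<lambda>t. \<Sum>k. c k $ i * t ^ k) has_real_derivative (\<Sum>k. diffs (\<lambda>k. c k $ i) k * t ^ k)) (at t)"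
      by (intro termdiffs_strong_converges_everywhere summ)
    ultimately show ?thesis by (simp add: \<xi>_def[abs_def])
  qed
  have "(x has_vector_derivative A *v x t + b) (at t)" for t
  proof -
    have "((\<lambda>t. \<xi> i t *\<^sub>R (axis i 1 :: real^'n)) has_vector_derivative (A *v x t + b) $ i *\<^sub>R axis i 1) (at t)" for i
      using has_vector_derivative_scaleR[OF deriv has_vector_derivative_const] by simp
    then have "((\<lambda>t. \<Sum>i\<in>UNIV. \<xi> i t *\<^sub>R (axis i 1 :: real^'n)) has_vector_derivative
        (\<Sum>i\<in>UNIV. (A *v x t + b) $ i *\<^sub>R axis i 1)) (at t)"
      by (intro has_vector_derivative_sum)
    moreover have expand: "(\<Sum>i\<in>UNIV. y $ i *\<^sub>R axis i 1) = y" for y :: "real^'n"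
      using basis_expansion[of y] by (simp add: scalar_mult_eq_scaleR)
    moreover have "(\<Sum>i\<in>UNIV. \<xi> i s *\<^sub>R axis i 1) = x s" for s
      using expand[of "x s"] by (simp add: x_def)
    ultimately show ?thesis by (simp only:)
  qed
  moreover have "x 0 = x\<^sub>0"
    using sums[of _ 0] by (simp add: x_def vec_eq_iff \<xi>_def c0)
  ultimately show ?thesis by (rule that[rotated])
qed

text \<open>The dissipation inequality along the trajectory with constant input through the given
  point, differentiated at time 0.\<close>
lemma passive_std_lmi:
  fixes A :: "real^'n^'n" and B :: "real^'m^'n" and C :: "real^'n^'m" and D :: "real^'m^'m"
  assumes "passive_std A B C D"
  shows "x\<^sub>0 \<bullet> (A *v x\<^sub>0 + B *v z) \<le> z \<bullet> (C *v x\<^sub>0 + D *v z)"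
proof (rule ccontr)
  assume neg: "\<not> ?thesis"
  obtain x where x: "x 0 = x\<^sub>0" "\<And>t. (x has_vector_derivative A *v x t + B *v z) (at t)"
    using affine_ode_solution by blast
  have cx: "continuous_on S x" for S
    using x(2) by (intro continuous_at_imp_continuous_on ballI) (blast intro: has_vector_derivative_continuous)
  have cm: "continuous_on S (\<lambda>t. E *v x t)" for S and E :: "real^'n^'k"
    using cx by (intro bounded_linear.continuous_on[OF matrix_vector_mul_bounded_linear])
  define w where "w s = z \<bullet> (C *v x s + D *v z)" for s
  \<comment> \<open>Stored energy minus supplied energy. Passivity gives
    \<open>g h \<le> g 0\<close> for positive \<open>h\<close>, whereas failure of the claim would
    make the right derivative of \<open>g\<close> at 0 positive.\<close>
  define g where "g h = (1/2) * (x h \<bullet> x h) - integral {0..h} w" for h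
  have cw: "continuous_on S w" for S unfolding w_def by (intro continuous_intros cm)
  have le: "g h \<le> g 0" if "h > 0" for h
  proof -
    have I: "((\<lambda>s. A *v x s + B *v z) has_integral x t - x 0) {0..t}" if "t \<in> {0..h}" for t
      using that x(2) by (intro fundamental_theorem_of_calculus) (auto intro: has_vector_derivative_at_within)
    have "\<forall>t\<in>{0..h}. x t = x 0 + integral {0..t} (\<lambda>s. A *v x s + B *v z)"
      using integral_unique[OF I] by simp
    moreover have "(\<lambda>s. A *v x s + B *v z) absolutely_integrable_on {0..h}"
      by (intro absolutely_integrable_continuous_real continuous_intros cm)
    moreover have "(\<lambda>s. z) measurable_on {0..h}" by simp
    moreover have "(\<lambda>s. (norm z)\<^sup>2) integrable_on {0..h}" by (rule integrable_const_ivl)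
    ultimately have "(1/2) * (norm (x h))\<^sup>2 \<le> (1/2) * (norm (x 0))\<^sup>2 + integral {0..h} (\<lambda>s. z \<bullet> (C *v x s + D *v z))"
      using assms[unfolded passive_std_def, rule_format, of 0 h "\<lambda>_. z" x] that by blast
    then show ?thesis by (simp add: g_def w_def[abs_def] power2_norm_eq_inner)
  qed
  have "((\<lambda>h. x h \<bullet> x h) has_real_derivative (x\<^sub>0 \<bullet> (A *v x\<^sub>0 + B *v z) + (A *v x\<^sub>0 + B *v z) \<bullet> x\<^sub>0)) (at 0 within {0..1})"
    using bounded_bilinear.has_vector_derivative[OF bounded_bilinear_inner
        has_vector_derivative_at_within[OF x(2)[of 0]] has_vector_derivative_at_within[OF x(2)[of 0]]]
    by (simp only: has_real_derivative_iff_has_vector_derivative x(1))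
  then have "((\<lambda>h. (1/2) * (x h \<bullet> x h)) has_real_derivative (1/2) * (x\<^sub>0 \<bullet> (A *v x\<^sub>0 + B *v z) + (A *v x\<^sub>0 + B *v z) \<bullet> x\<^sub>0)) (at 0 within {0..1})"
    by (rule DERIV_cmult)
  moreover have "((\<lambda>h. integral {0..h} w) has_real_derivative w 0) (at 0 within {0..1})"
    by (intro integral_has_real_derivative cw) auto
  ultimately have "(g has_real_derivative
      (1/2) * (x\<^sub>0 \<bullet> (A *v x\<^sub>0 + B *v z) + (A *v x\<^sub>0 + B *v z) \<bullet> x\<^sub>0) - w 0) (at 0 within {0..1})"
    unfolding g_def by (rule DERIV_diff)
  moreover have "(1/2) * (x\<^sub>0 \<bullet> (A *v x\<^sub>0 + B *v z) + (A *v x\<^sub>0 + B *v z) \<bullet> x\<^sub>0) - w 0 > 0"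
    using neg by (simp add: w_def x(1) inner_commute)
  ultimately obtain d where d: "d > 0" "\<And>h. \<lbrakk>h > 0; 0 + h \<in> {0..1}; h < d\<rbrakk> \<Longrightarrow> g 0 < g (0 + h)"
    using has_real_derivative_pos_inc_right by blast
  have "g 0 < g (0 + min (d/2) 1)" using d(1) by (intro d(2)) auto
  then show False using le[of "min (d/2) 1"] d(1) by simp
qed

subsection \<open>The operator H\<close>

lemma mem_H_P:
  "y \<in> H_P A B C D v t x \<longleftrightarrow> (\<exists>z\<in>P_plus_D_inv D (C *v x + v t). y = - (A *v x) + B *v z)"
  by (auto simp: H_P_def)

lemma mem_dom_H_P: "x \<in> dom_op (H_P A B C D v t) \<longleftrightarrow> (\<exists>z. z \<in> P_plus_D_inv D (C *v x + v t))"
  by (auto simp: dom_op_def H_P_def)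

lemma P_plus_D_inv_orthogonal:
  assumes "z \<in> P_plus_D_inv D \<eta>"
  shows "z \<bullet> (\<eta> - D *v z) = 0"
proof -
  have "z $ i * (\<eta> - D *v z) $ i = 0" for i using assms unfolding mem_P_plus_D_inv by auto
  then show ?thesis unfolding inner_vec_def inner_real_def by (intro sum.neutral) blast
qed

text \<open>With slacks \<open>p\<close> and \<open>p'\<close>, the products
  \<open>z \<bullet> p\<close> and \<open>z' \<bullet> p'\<close> vanish and the cross products are
  nonpositive, so (z - z') . (p - p') \<ge> 0. The dissipation inequality for the differences, with
  input -(z - z'), carries this over to \<open>x\<close> and \<open>y\<close>.\<close>

lemma H_P_monotone:
  fixes A :: "real^'n^'n" and B :: "real^'m^'n" and C :: "real^'n^'m" and D :: "real^'m^'m"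
  assumes lmi: "\<And>x z. x \<bullet> (A *v x + B *v z) \<le> z \<bullet> (C *v x + D *v z)"
  shows "monotone_op (H_P A B C D v t)"
  unfolding monotone_op_def mem_H_P
proof (intro allI impI, elim conjE bexE)
  fix x y x' y' z z'
  assume z: "z \<in> P_plus_D_inv D (C *v x + v t)" "y = - (A *v x) + B *v z"
    and z': "z' \<in> P_plus_D_inv D (C *v x' + v t)" "y' = - (A *v x') + B *v z'"
  define p where "p = C *v x + v t - D *v z"
  define p' where "p' = C *v x' + v t - D *v z'"
  have "z \<bullet> p = 0" "z' \<bullet> p' = 0"
    using P_plus_D_inv_orthogonal[OF z(1)] P_plus_D_inv_orthogonal[OF z'(1)] by (simp_all add: p_def p'_def)
  moreover have "z \<bullet> p' \<le> 0" "z' \<bullet> p \<le> 0"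
    unfolding p_def p'_def using z(1) z'(1) unfolding mem_P_plus_D_inv
    by (intro nonpos_inner_nonneg; blast)+
  ultimately have "0 \<le> (z - z') \<bullet> (p - p')" by (simp add: inner_diff_left inner_diff_right)
  also have "p - p' = C *v (x - x') + D *v (- (z - z'))"
    by (simp add: p_def p'_def matrix_vector_mult_diff_distrib vec.neg algebra_simps)
  finally have "(- (z - z')) \<bullet> (C *v (x - x') + D *v (- (z - z'))) \<le> 0"
    by (simp only: inner_minus_left neg_le_0_iff_le)
  with lmi[of "x - x'" "- (z - z')"]
  have "(x - x') \<bullet> (A *v (x - x') + B *v (- (z - z'))) \<le> 0" by linarith
  moreover have "A *v (x - x') + B *v (- (z - z')) = - (y - y')"
    by (simp add: z(2) z'(2) matrix_vector_mult_diff_distrib vec.neg algebra_simps)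
  ultimately have "(x - x') \<bullet> (- (y - y')) \<le> 0" by (simp only:)
  then show "0 \<le> (y - y') \<bullet> (x - x')"
    by (simp only: inner_minus_right neg_le_0_iff_le inner_commute[of "y - y'"])
qed

section \<open>General facts on maximal monotone operators and least-norm elements\<close>

lemma minty_maximal_monotone:
  fixes G :: "'a::real_inner \<Rightarrow> 'a set"
  assumes mono: "monotone_op G" and surj: "\<And>y. \<exists>x. y - x \<in> G x"
  shows "maximal_monotone_op G"
  unfolding maximal_monotone_op_def
proof (intro conjI allI impI mono, elim conjE, rule antisym)
  fix G' assume G': "monotone_op G'" "graph_op G \<subseteq> graph_op G'"
  show "graph_op G' \<subseteq> graph_op G"
  proof
    fix w assume w: "w \<in> graph_op G'"
    obtain x y where xy: "w = (x, y)" by (cases w)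
    \<comment> \<open>The point \<open>x1\<close> solves x + y \<in> x1 + G x1. Comparing it with
      (x, y) inside the monotone extension forces \<open>x1 = x\<close>.\<close>
    obtain x1 where x1: "x + y - x1 \<in> G x1" using surj[of "x + y"] by blast
    then have "x + y - x1 \<in> G' x1" using G'(2) by (auto simp: graph_op_def)
    moreover have "y \<in> G' x" using w xy by (simp add: graph_op_def)
    ultimately have "0 \<le> (y - (x + y - x1)) \<bullet> (x - x1)" using G'(1) unfolding monotone_op_def by blast
    moreover have "y - (x + y - x1) = - (x - x1)" by simp
    ultimately have "(x - x1) \<bullet> (x - x1) \<le> 0" by (metis inner_minus_left neg_0_le_iff_le)
    then have "(x - x1) \<bullet> (x - x1) = 0" by (intro antisym) simp_all
    then have "x1 = x" by simp
    then show "w \<in> graph_op G" using x1 xy by (simp add: graph_op_def)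
  qed
qed blast

text \<open>A \<open>y\<close> satisfying all these inequalities could be added to the graph at
  \<open>x\<close> without losing monotonicity, so maximality already contains it. As an
  intersection of half-spaces, the value is closed and convex.\<close>

lemma maximal_monotone_op_values:
  fixes G :: "'a::real_inner \<Rightarrow> 'a set"
  assumes "maximal_monotone_op G"
  shows "G x = (\<Inter>(x', y')\<in>graph_op G. {y. (x - x') \<bullet> y \<ge> (x - x') \<bullet> y'})"
proof -
  have swap: "0 \<le> (u - w) \<bullet> d \<longleftrightarrow> d \<bullet> w \<le> d \<bullet> u" for u w d :: 'a
    by (simp add: inner_commute[of _ d] inner_diff_right)
  show ?thesis
  proof (intro equalityI subsetI)
    fix y assume "y \<in> G x"
    then have "0 \<le> (y - y') \<bullet> (x - x')" if "(x', y') \<in> graph_op G" for x' y'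
      using assms that unfolding maximal_monotone_op_def monotone_op_def graph_op_def by blast
    then show "y \<in> (\<Inter>(x', y')\<in>graph_op G. {y. (x - x') \<bullet> y \<ge> (x - x') \<bullet> y'})"
      unfolding swap by blast
  next
    fix y assume y: "y \<in> (\<Inter>(x', y')\<in>graph_op G. {y. (x - x') \<bullet> y \<ge> (x - x') \<bullet> y'})"
    define G' where "G' = G(x := insert y (G x))"
    have rel: "0 \<le> (y - y') \<bullet> (x - x')" if "y' \<in> G x'" for x' y'
      using y that unfolding swap graph_op_def by blast
    have "monotone_op G'"
      unfolding monotone_op_def
    proof (intro allI impI, elim conjE)
      fix x1 y1 x2 y2 assume 12: "y1 \<in> G' x1" "y2 \<in> G' x2"
      then have c1: "y1 \<in> G x1 \<or> (x1 = x \<and> y1 = y)" and c2: "y2 \<in> G x2 \<or> (x2 = x \<and> y2 = y)"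
        by (auto simp: G'_def split: if_splits)
      have G: "y1 \<in> G x1 \<Longrightarrow> y2 \<in> G x2 \<Longrightarrow> 0 \<le> (y1 - y2) \<bullet> (x1 - x2)"
        using assms unfolding maximal_monotone_op_def monotone_op_def by blast
      have flip: "(y1 - y) \<bullet> (x1 - x) = (y - y1) \<bullet> (x - x1)"
        by (simp add: inner_diff_left inner_diff_right)
      show "0 \<le> (y1 - y2) \<bullet> (x1 - x2)"
        using c1 c2 G rel[of y1 x1] rel[of y2 x2] flip by auto
    qed
    moreover have "graph_op G \<subseteq> graph_op G'" by (auto simp: graph_op_def G'_def)
    ultimately have "graph_op G' = graph_op G"
      using assms unfolding maximal_monotone_op_def by blast
    moreover have "(x, y) \<in> graph_op G'" by (simp add: graph_op_def G'_def)
    ultimately show "y \<in> G x" by (simp add: graph_op_def)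
  qed
qed

text \<open>The definite description denotes the minimiser only when it is unique: closedness gives
  existence, convexity gives uniqueness, and it is the point closest to 0.\<close>

lemma norm_least_norm_elem_le:
  fixes S :: "'a::euclidean_space set"
  assumes "closed S" "convex S" "y \<in> S"
  shows "norm (least_norm_elem S) \<le> norm y"
proof -
  define c where "c = closest_point S 0"
  have c: "c \<in> S" "\<And>y. y \<in> S \<Longrightarrow> norm c \<le> norm y"
    using closest_point_exists[OF assms(1), of 0] assms(3) by (auto simp: c_def)
  have "least_norm_elem S = c"
    unfolding least_norm_elem_def
  proof (rule the_equality)
    fix w assume "w \<in> S \<and> (\<forall>y'\<in>S. norm w \<le> norm y')"
    then show "w = c"
      unfolding c_def using assms by (intro closest_point_unique) auto
  qed (use c in blast)
  then show ?thesis using c assms(3) by simp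
qed

section \<open>Maximality, domains, growth and closed graph for H\<close>

lemma H_P_maximal_monotone:
  fixes A :: "real^'n^'n" and B :: "real^'m^'n" and C :: "real^'n^'m" and D :: "real^'m^'m"
  assumes lmi: "\<And>x z. x \<bullet> (A *v x + B *v z) \<le> z \<bullet> (C *v x + D *v z)"
    and dom: "dom_op (H_P A B C D v t) \<noteq> {}"
  shows "maximal_monotone_op (H_P A B C D v t)"
proof (rule minty_maximal_monotone[OF H_P_monotone[OF lmi]])
  fix y
  obtain x0 where "x0 \<in> dom_op (H_P A B C D v t)" using dom by blast
  then obtain z0 where z0: "z0 \<in> P_plus_D_inv D (C *v x0 + v t)" unfolding mem_dom_H_P by blast
  then have "0 \<le> (C *v x0 + v t - D *v z0) $ i" "z0 $ i \<le> 0" for i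
    unfolding mem_P_plus_D_inv by blast+
  then obtain x z where "z \<in> P_plus_D_inv D (C *v x + v t)" "y = x - A *v x + B *v z"
    by (rule passive_resolvent_surjective[OF lmi])
  then have "y - x \<in> H_P A B C D v t x" unfolding mem_H_P by (intro bexI[of _ z]) auto
  then show "\<exists>x. y - x \<in> H_P A B C D v t x" by blast
qed

text \<open>With u = (x, z) and q = v(t), the sign conditions alone define a polyhedron whose
  projection to x is the domain. The constant depends on this system of constraints and not on v, s
  or t.\<close>

lemma dom_H_P_lipschitz:
  fixes A :: "real^'n^'n" and B :: "real^'m^'n" and C :: "real^'n^'m" and D :: "real^'m^'m"
  assumes psd: "\<And>z. 0 \<le> z \<bullet> (D *v z)"
  obtains c where "c \<ge> 0"
    "\<And>v s t x. \<lbrakk>x \<in> dom_op (H_P A B C D v s); dom_op (H_P A B C D v t) \<noteq> {}\<rbrakk>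
       \<Longrightarrow> infdist x (dom_op (H_P A B C D v t)) \<le> c * norm (v t - v s)"
proof -
  define G :: "((((real^'n) \<times> (real^'m)) \<times> (real^'m)) \<Rightarrow> real) set" where
    "G = range (\<lambda>i w. snd (fst w) $ i) \<union> range (\<lambda>i w. - (C *v fst (fst w) + snd w - D *v snd (fst w)) $ i)"
  have G: "(\<forall>g\<in>G. g ((x, z), q) \<le> 0) \<longleftrightarrow> (\<forall>i. z $ i \<le> 0) \<and> (\<forall>i. 0 \<le> (C *v x + q - D *v z) $ i)" for x z q
    unfolding G_def by (auto simp: ball_Un)
  have "\<exists>c\<ge>0. \<forall>u q q'. (\<forall>g\<in>G. g (u, q) \<le> 0) \<and> (\<exists>u'. \<forall>g\<in>G. g (u', q') \<le> 0) \<longrightarrow>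
           (\<exists>u'. (\<forall>g\<in>G. g (u', q') \<le> 0) \<and> norm (u' - u) \<le> c * norm (q' - q))"
  proof (rule polyhedral_section_lipschitz)
    show "finite G" by (simp add: G_def)
    show "\<forall>g\<in>G. linear g"
      by (auto simp: G_def linear_iff matrix_vector_right_distrib matrix_vector_mult_scaleR algebra_simps)
  qed
  then obtain c where c: "c \<ge> 0" "\<And>u q q'. \<lbrakk>\<forall>g\<in>G. g (u, q) \<le> 0; \<exists>u'. \<forall>g\<in>G. g (u', q') \<le> 0\<rbrakk> \<Longrightarrow>
           \<exists>u'. (\<forall>g\<in>G. g (u', q') \<le> 0) \<and> norm (u' - u) \<le> c * norm (q' - q)"
    by blast
  show ?thesis
  proof (rule that[OF c(1)])
    fix v :: "real \<Rightarrow> real^'m" and s t x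
    assume "x \<in> dom_op (H_P A B C D v s)" and ne: "dom_op (H_P A B C D v t) \<noteq> {}"
    then obtain z where "z \<in> P_plus_D_inv D (C *v x + v s)" unfolding mem_dom_H_P by blast
    then have 1: "\<forall>g\<in>G. g ((x, z), v s) \<le> 0" unfolding G mem_P_plus_D_inv by blast
    obtain x0 where "x0 \<in> dom_op (H_P A B C D v t)" using ne by blast
    then obtain z0 where "z0 \<in> P_plus_D_inv D (C *v x0 + v t)" unfolding mem_dom_H_P by blast
    then have "\<forall>g\<in>G. g ((x0, z0), v t) \<le> 0" unfolding G mem_P_plus_D_inv by blast
    then obtain u' where u': "\<forall>g\<in>G. g (u', v t) \<le> 0" "norm (u' - (x, z)) \<le> c * norm (v t - v s)"
      using c(2)[OF 1] by blast
    obtain x' z' where xz': "u' = (x', z')" by (cases u')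
    have feas: "\<forall>i. z' $ i \<le> 0" "\<forall>i. 0 \<le> (C *v x' + v t - D *v z') $ i" using u'(1) unfolding xz' G by auto
    \<comment> \<open>The displaced \<open>z'\<close> need not be complementary. It witnesses
      feasibility at \<open>x'\<close>, which suffices to find a complementary \<open>z''\<close> at
      the same state.\<close>
    obtain z'' where "z'' \<in> P_plus_D_inv D (C *v x' + v t)"
      by (rule P_plus_D_inv_nonempty_if_feasible[OF psd feas(2)[rule_format] feas(1)[rule_format]])
    then have "x' \<in> dom_op (H_P A B C D v t)" unfolding mem_dom_H_P by blast
    then have "infdist x (dom_op (H_P A B C D v t)) \<le> dist x x'" by (rule infdist_le)
    also have "\<dots> \<le> norm (u' - (x, z))"
      using norm_fst_le[of "x' - x" "z' - z"] by (simp add: xz' dist_norm norm_minus_commute)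
    finally show "infdist x (dom_op (H_P A B C D v t)) \<le> c * norm (v t - v s)" using u'(2) by linarith
  qed
qed

lemma H_P_linear_growth:
  fixes A :: "real^'n^'n" and B :: "real^'m^'n" and C :: "real^'n^'m" and D :: "real^'m^'m"
  obtains K where "K \<ge> 0" "\<And>v t x. x \<in> dom_op (H_P A B C D v t) \<Longrightarrow>
      \<exists>y\<in>H_P A B C D v t x. norm y \<le> K * (norm x + norm (v t))"
proof -
  \<comment> \<open>The zero output matrix yields a bound in terms of \<eta> alone. Using B here
    would put \<open>norm (B *v z)\<close>, the quantity to be estimated, on the right-hand
    side.\<close>
  obtain c where c: "c \<ge> 0" "\<And>\<eta> z. z \<in> P_plus_D_inv D \<eta> \<Longrightarrow>
     \<exists>z'\<in>P_plus_D_inv D \<eta>. (0 :: real^'m^'m) *v z' = 0 *v z \<and> norm z' \<le> c * norm (\<eta>, (0 :: real^'m^'m) *v z)"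
    using P_plus_D_inv_bounded_selection[of D "0 :: real^'m^'m"] by blast
  obtain a where a: "a > 0" "\<And>x. norm (A *v x) \<le> norm x * a"
    using bounded_linear.pos_bounded[OF matrix_vector_mul_bounded_linear[of A]] by blast
  obtain b where b: "b > 0" "\<And>x. norm (B *v x) \<le> norm x * b"
    using bounded_linear.pos_bounded[OF matrix_vector_mul_bounded_linear[of B]] by blast
  obtain d where d: "d > 0" "\<And>x. norm (C *v x) \<le> norm x * d"
    using bounded_linear.pos_bounded[OF matrix_vector_mul_bounded_linear[of C]] by blast
  define K where "K = a + c * b * d + c * b"
  have "\<exists>y\<in>H_P A B C D v t x. norm y \<le> K * (norm x + norm (v t))"
    if x: "x \<in> dom_op (H_P A B C D v t)" for v t x
  proof -
    obtain z where z: "z \<in> P_plus_D_inv D (C *v x + v t)" "norm z \<le> c * norm (C *v x + v t)"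
      using x c(2) unfolding mem_dom_H_P by (auto simp: norm_Pair)
    have "norm (- (A *v x) + B *v z) \<le> norm (A *v x) + norm (B *v z)"
      using norm_triangle_ineq[of "- (A *v x)" "B *v z"] by simp
    also have "norm (A *v x) \<le> norm x * a" by (rule a)
    also have "norm (B *v z) \<le> norm z * b" by (rule b)
    also have "norm z * b \<le> (c * norm (C *v x + v t)) * b" using z(2) b(1) by (intro mult_right_mono) auto
    also have "\<dots> \<le> (c * (norm x * d + norm (v t))) * b"
      using norm_triangle_ineq[of "C *v x" "v t"] d(2)[of x] b(1) c(1)
      by (intro mult_right_mono mult_left_mono) auto
    also have "norm x * a + (c * (norm x * d + norm (v t))) * b = (a + c * b * d) * norm x + (c * b) * norm (v t)"
      by (simp add: algebra_simps)
    also have "\<dots> \<le> K * norm x + K * norm (v t)"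
      using a(1) b(1) c(1) d(1) by (intro add_mono mult_right_mono) (auto simp: K_def)
    finally have "norm (- (A *v x) + B *v z) \<le> K * (norm x + norm (v t))" by (simp add: distrib_left)
    moreover have "- (A *v x) + B *v z \<in> H_P A B C D v t x" using z(1) unfolding mem_H_P by blast
    ultimately show ?thesis by blast
  qed
  moreover have "K \<ge> 0" using a(1) b(1) c(1) d(1) by (simp add: K_def)
  ultimately show ?thesis using that by blast
qed

text \<open>The multipliers \<open>z l\<close> need not converge, but \<open>B *v z l\<close> equals
  \<open>y l + A *v x l\<close>, which does; that is the form in which closedness was
  proved.\<close>

lemma H_P_outer_semicontinuous:
  fixes A :: "real^'n^'n" and B :: "real^'m^'n" and C :: "real^'n^'m" and D :: "real^'m^'m"
  assumes mem: "\<And>l. (x l, y l) \<in> graph_op (H_P A B C D v (t l))"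
    and lims: "(\<lambda>l. v (t l)) \<longlonglongrightarrow> v t\<^sub>0" "x \<longlonglongrightarrow> x\<^sub>0" "y \<longlonglongrightarrow> y\<^sub>0"
  shows "(x\<^sub>0, y\<^sub>0) \<in> graph_op (H_P A B C D v t\<^sub>0)"
proof -
  have "\<forall>l. \<exists>z. z \<in> P_plus_D_inv D (C *v x l + v (t l)) \<and> y l = - (A *v x l) + B *v z"
    using mem by (auto simp: graph_op_def mem_H_P)
  then obtain z where z: "\<And>l. z l \<in> P_plus_D_inv D (C *v x l + v (t l))" "\<And>l. y l = - (A *v x l) + B *v z l"
    by metis
  have mult: "(\<lambda>l. E *v x l) \<longlonglongrightarrow> E *v x\<^sub>0" for E :: "real^'n^'k"
    by (intro bounded_linear.tendsto[OF matrix_vector_mul_bounded_linear] lims)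
  have "(\<lambda>l. y l + A *v x l) \<longlonglongrightarrow> y\<^sub>0 + A *v x\<^sub>0" by (intro tendsto_add lims mult)
  then have "(\<lambda>l. B *v z l) \<longlonglongrightarrow> y\<^sub>0 + A *v x\<^sub>0" by (simp add: z(2))
  moreover have "(\<lambda>l. C *v x l + v (t l)) \<longlonglongrightarrow> C *v x\<^sub>0 + v t\<^sub>0" by (intro tendsto_add lims mult)
  ultimately obtain z0 where "z0 \<in> P_plus_D_inv D (C *v x\<^sub>0 + v t\<^sub>0)" "B *v z0 = y\<^sub>0 + A *v x\<^sub>0"
    using P_plus_D_inv_closed[of z D "\<lambda>l. C *v x l + v (t l)", OF z(1)] by blast
  then have "y\<^sub>0 \<in> H_P A B C D v t\<^sub>0 x\<^sub>0" unfolding mem_H_P by (intro bexI[of _ z0]) auto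
  then show ?thesis by (simp add: graph_op_def)
qed

theorem theorem21:
  fixes T :: real
    and A :: "real^'n^'n" and B :: "real^'m^'n" and C :: "real^'n^'m" and D :: "real^'m^'m"
    and v :: "real \<Rightarrow> real^'m"
  assumes "T > 0"
    and pass: "passive_std A B C D"
    and rint_cond: "\<forall>t\<in>{0..T}. range (\<lambda>x. C *v x) \<inter>
                 rel_interior ((\<lambda>y. y - v t) ` im_op (P_plus_D D)) \<noteq> {}"
    and v_ac: "abs_continuous_on {0..T} v"
  shows
    "(\<forall>t\<in>{0..T}. maximal_monotone_op (H_P A B C D v t))
     \<and> (\<exists>\<phi>::real \<Rightarrow> real. mono_on {0..T} \<phi> \<and> abs_continuous_on {0..T} \<phi> \<and>
          (\<forall>s t. 0 \<le> s \<and> s \<le> t \<and> t \<le> T \<longrightarrow>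
             (\<forall>z\<in>dom_op (H_P A B C D v s).
                dom_op (H_P A B C D v t) \<noteq> {} \<and>
                infdist z (dom_op (H_P A B C D v t)) \<le> \<phi> t - \<phi> s)))
     \<and> (\<forall>r>0. \<exists>\<sigma>::real \<Rightarrow> real. \<sigma> absolutely_integrable_on {0..T} \<and>
          (\<forall>t\<in>{0..T}. 0 \<le> \<sigma> t) \<and>
          (\<forall>t\<in>{0..T}. \<forall>x \<in> cball 0 r \<inter> dom_op (H_P A B C D v t).
             norm (least_norm_elem (H_P A B C D v t x)) \<le> \<sigma> t * (1 + norm x)))
     \<and> (\<forall>t\<^sub>0\<in>{0..T}. \<forall>(tl::nat \<Rightarrow> real) (xl::nat \<Rightarrow> real^'n) (yl::nat \<Rightarrow> real^'n) x y.
          (\<forall>l. tl l \<in> {0..T}) \<and> tl \<longlonglongrightarrow> t\<^sub>0 \<and>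
          (\<forall>l. (xl l, yl l) \<in> graph_op (H_P A B C D v (tl l))) \<and>
          xl \<longlonglongrightarrow> x \<and> yl \<longlonglongrightarrow> y
          \<longrightarrow> (x, y) \<in> graph_op (H_P A B C D v t\<^sub>0))"
proof (intro conjI)
  have lmi: "x \<bullet> (A *v x + B *v z) \<le> z \<bullet> (C *v x + D *v z)" for x z
    using pass by (rule passive_std_lmi)
  have psd: "0 \<le> z \<bullet> (D *v z)" for z using lmi[of 0 z] by simp
  have dom: "dom_op (H_P A B C D v t) \<noteq> {}" if "t \<in> {0..T}" for t
  proof -
    have "range (\<lambda>x. C *v x) \<inter> rel_interior ((\<lambda>y. y - v t) ` im_op (P_plus_D D)) \<noteq> {}"
      using rint_cond that by (rule bspec)
    then have "range (\<lambda>x. C *v x) \<inter> (\<lambda>y. y - v t) ` im_op (P_plus_D D) \<noteq> {}"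
      using rel_interior_subset by fast
    then obtain x y where "C *v x = y - v t" "y \<in> im_op (P_plus_D D)" by fast
    then obtain z where "C *v x + v t \<in> P_plus_D D z" by (auto simp: im_op_def)
    then have "x \<in> dom_op (H_P A B C D v t)" unfolding mem_dom_H_P P_plus_D_inv_def by blast
    then show ?thesis by blast
  qed
  show max: "\<forall>t\<in>{0..T}. maximal_monotone_op (H_P A B C D v t)"
    using H_P_maximal_monotone[OF lmi dom] by blast
  have cont: "continuous_on {0..T} v"
    using v_ac by (intro abs_continuous_on_imp_continuous_on is_interval_cc)

  interpret finite_variation v 0 T
    using \<open>T > 0\<close> v_ac by unfold_locales (auto intro: abs_continuous_on_variation_bdd)
  obtain c where c: "c \<ge> 0" "\<And>v s t x. \<lbrakk>x \<in> dom_op (H_P A B C D v s); dom_op (H_P A B C D v t) \<noteq> {}\<rbrakk>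
       \<Longrightarrow> infdist x (dom_op (H_P A B C D v t)) \<le> c * norm (v t - v s)"
    using dom_H_P_lipschitz[OF psd] by blast
  define \<phi> where "\<phi> t = c * variation_on v 0 t" for t
  have step: "c * norm (v t - v s) \<le> \<phi> t - \<phi> s" if "0 \<le> s" "s \<le> t" "t \<le> T" for s t
    using mult_left_mono[OF variation_extend[OF that] c(1)] by (simp add: \<phi>_def distrib_left)
  have "mono_on {0..T} \<phi>"
  proof (rule mono_onI)
    fix s t assume "s \<in> {0..T}" "t \<in> {0..T}" "s \<le> t"
    then show "\<phi> s \<le> \<phi> t" using step[of s t] mult_nonneg_nonneg[OF c(1) norm_ge_zero[of "v t - v s"]] by simp
  qed
  moreover have "abs_continuous_on {0..T} \<phi>"
    unfolding \<phi>_def using \<open>T > 0\<close> v_ac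
    by (intro abs_continuous_on_cmult abs_continuous_on_variation) auto
  moreover have "dom_op (H_P A B C D v t) \<noteq> {}" "infdist z (dom_op (H_P A B C D v t)) \<le> \<phi> t - \<phi> s"
    if "0 \<le> s" "s \<le> t" "t \<le> T" "z \<in> dom_op (H_P A B C D v s)" for s t z
  proof -
    show ne: "dom_op (H_P A B C D v t) \<noteq> {}" using that by (intro dom) auto
    show "infdist z (dom_op (H_P A B C D v t)) \<le> \<phi> t - \<phi> s"
      using c(2)[OF that(4) ne] step[OF that(1-3)] by linarith
  qed
  ultimately show "\<exists>\<phi>::real \<Rightarrow> real. mono_on {0..T} \<phi> \<and> abs_continuous_on {0..T} \<phi> \<and>
          (\<forall>s t. 0 \<le> s \<and> s \<le> t \<and> t \<le> T \<longrightarrow>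
             (\<forall>z\<in>dom_op (H_P A B C D v s).
                dom_op (H_P A B C D v t) \<noteq> {} \<and>
                infdist z (dom_op (H_P A B C D v t)) \<le> \<phi> t - \<phi> s))"
    by (intro exI[of _ \<phi>]) blast

  obtain K where K: "K \<ge> 0" "\<And>v t x. x \<in> dom_op (H_P A B C D v t) \<Longrightarrow>
      \<exists>y\<in>H_P A B C D v t x. norm y \<le> K * (norm x + norm (v t))"
    using H_P_linear_growth[of A B C D] by blast
  have "compact (v ` {0..T})" using cont by (intro compact_continuous_image) auto
  then obtain W where W: "W > 0" "\<And>t. t \<in> {0..T} \<Longrightarrow> norm (v t) \<le> W"
    using compact_imp_bounded bounded_pos by (metis imageI)
  \<comment> \<open>The growth estimate is global in \<open>x\<close>, so one constant function
    serves every radius. Expanding (W + 1)(1 + |x|) dominates |x| + |v(t)|.\<close>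
  have bound: "norm (least_norm_elem (H_P A B C D v t x)) \<le> K * (W + 1) * (1 + norm x)"
    if t: "t \<in> {0..T}" and x: "x \<in> dom_op (H_P A B C D v t)" for t x
  proof -
    obtain y where y: "y \<in> H_P A B C D v t x" "norm y \<le> K * (norm x + norm (v t))" using K(2)[OF x] by blast
    note vals = maximal_monotone_op_values[OF max[rule_format, OF t], of x]
    have "closed (H_P A B C D v t x)"
      unfolding vals by (intro closed_INT ballI) (auto simp: closed_halfspace_ge)
    moreover have "convex (H_P A B C D v t x)"
      unfolding vals by (intro convex_INT) (auto simp: convex_halfspace_ge)
    ultimately have "norm (least_norm_elem (H_P A B C D v t x)) \<le> K * (norm x + norm (v t))"
      using norm_least_norm_elem_le y by (meson order_trans)
    also have "\<dots> \<le> K * ((W + 1) * (1 + norm x))"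
    proof (rule mult_left_mono[OF _ K(1)])
      have "0 \<le> W * norm x" using W(1) by simp
      then show "norm x + norm (v t) \<le> (W + 1) * (1 + norm x)" using W(2)[OF t] by (simp add: algebra_simps)
    qed
    finally show ?thesis by (simp add: mult.assoc)
  qed
  have int: "(\<lambda>_. K * (W + 1)) absolutely_integrable_on {0..T}"
    by (intro absolutely_integrable_continuous_real continuous_on_const)
  have "0 \<le> K * (W + 1)" using K(1) W(1) by simp
  then show "\<forall>r>0. \<exists>\<sigma>::real \<Rightarrow> real. \<sigma> absolutely_integrable_on {0..T} \<and>
          (\<forall>t\<in>{0..T}. 0 \<le> \<sigma> t) \<and>
          (\<forall>t\<in>{0..T}. \<forall>x \<in> cball 0 r \<inter> dom_op (H_P A B C D v t).
             norm (least_norm_elem (H_P A B C D v t x)) \<le> \<sigma> t * (1 + norm x))"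
    using bound int by (intro allI impI exI[of _ "\<lambda>_. K * (W + 1)"]) blast

  show "\<forall>t\<^sub>0\<in>{0..T}. \<forall>(tl::nat \<Rightarrow> real) (xl::nat \<Rightarrow> real^'n) (yl::nat \<Rightarrow> real^'n) x y.
          (\<forall>l. tl l \<in> {0..T}) \<and> tl \<longlonglongrightarrow> t\<^sub>0 \<and>
          (\<forall>l. (xl l, yl l) \<in> graph_op (H_P A B C D v (tl l))) \<and>
          xl \<longlonglongrightarrow> x \<and> yl \<longlonglongrightarrow> y
          \<longrightarrow> (x, y) \<in> graph_op (H_P A B C D v t\<^sub>0)"
  proof (intro ballI allI impI, elim conjE)
    fix t\<^sub>0 tl and xl yl :: "nat \<Rightarrow> real^'n" and x y
    assume t: "t\<^sub>0 \<in> {0..T}" "\<forall>l. tl l \<in> {0..T}" "tl \<longlonglongrightarrow> t\<^sub>0"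
      and mem: "\<forall>l. (xl l, yl l) \<in> graph_op (H_P A B C D v (tl l))" and xy: "xl \<longlonglongrightarrow> x" "yl \<longlonglongrightarrow> y"
    have "(\<lambda>l. v (tl l)) \<longlonglongrightarrow> v t\<^sub>0"
      by (rule continuous_on_tendsto_compose[OF cont t(3,1)]) (use t(2) in simp)
    then show "(x, y) \<in> graph_op (H_P A B C D v t\<^sub>0)"
      by (rule H_P_outer_semicontinuous[where t = tl, OF mem[rule_format] _ xy])
  qed
qed

end
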